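(* Let $A$ and $B$ be $6\times 6$ complex matrices satisfying $$\operatorname{rank}(A:B)=6\quad\text{and}\quad AC_6A^*=BC_6B^*.$$ Let $Z$ be the $12\times 12$ matrix $$Z=\frac1{\sqrt2}\begin{pmatrix} I_3&I_3&0&0\\ I_3&-I_3&0&0\\ 0&0&I_3&I_3\\ 0&0&I_3&-I_3\end{pmatrix}\begin{pmatrix} I_3&0&0&0\\ 0&iC_3&0&0\\ 0&0&I_3&0\\ 0&0&0&iC_3\end{pmatrix}.$$ Then there exist a $6\times 6$ non-singular complex matrix $U$, $3\times 3$ unitary matrices $U_1,U_2,V_1,V_2$, and $3\times 3$ positive semi-definite diagonal matrices $C$ and $S$ with $C^2+S^2=I_3$, such that $$(A:B)=U\begin{pmatrix} C&I_3&0&S\\ -S&0&I_3&C\end{pmatrix}\begin{pmatrix} V_1&0&0&0\\ 0&U_1^*&0&0\\ 0&0&U_2^*&0\\ 0&0&0&V_2\end{pmatrix}Z,$$ and the boundary conditions $AY(a)+BY(b)=0$ are (1) separated, if and only if $S=0$; (2) mixed, if and only if $0<\operatorname{rank}(S)<3$; (3) coupled, if and only if $\operatorname{rank}(S)=3$.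
   Context: For matrices $A,B$ with the same number of rows, $(A:B)$ denotes the block matrix obtained by placing $A$ and $B$ side by side. $M^*$ denotes the conjugate transpose of $M$, $I_m$ is the $m\times m$ identity matrix, and $i$ is the imaginary unit. The matrix $C_6$ is $C_6=\left((-1)^r\delta_{r,7-s}\right)_{r,s=1}^6$, where $\delta$ is the Kronecker delta, and $$C_3=\begin{pmatrix}0&0&-1\\0&1&0\\-1&0&0\end{pmatrix}.$$ (The symbol $C$ without subscript is a different matrix, as introduced in the claim.) Here $Y=(y,y',y'',y^{[3]},y^{[4]},y^{[5]})^{\top}$ is the vector of quasi-derivatives of a function $y$ on an interval $(a,b)$, $-\infty\le a<b\le\infty$, associated with a sixth order differential equation, and the pair $(A,B)$ encodes the boundary conditions $AY(a)+BY(b)=0$. It is known that if $\operatorname{rank}(A:B)=6$ and $AC_6A^*=BC_6B^*$, then $\operatorname{rank}A=\operatorname{rank}B=3+r$ for some $r\in\{0,1,2,3\}$. For such $(A,B)$ the boundary conditions are by definition: separated if $r=0$; mixed if $r\in\{1,2\}$; coupled if $r=3$. Thus the type depends only on the common rank of $A$ and $B$. *)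

theory Defs
  imports
    "Jordan_Normal_Form.DL_Rank"
    "Jordan_Normal_Form.Schur_Decomposition"
begin

definition append_cols :: "'a :: zero mat \<Rightarrow> 'a mat \<Rightarrow> 'a mat" (infixr \<open>@\<^sub>c\<close> 65) where
  "A @\<^sub>c B = four_block_mat A B (0\<^sub>m 0 (dim_col A)) (0\<^sub>m 0 (dim_col B))"

definition unitary_mat :: "complex mat \<Rightarrow> bool" where
  "unitary_mat U \<longleftrightarrow> square_mat U \<and> inverts_mat U (mat_adjoint U) \<and> inverts_mat (mat_adjoint U) U"

text \<open>The order on \<^typ>\<open>complex\<close> is the partial one: \<open>0 \<le> z\<close> says that \<open>z\<close> is real and
  nonnegative. Since \<open>v \<bullet>c w\<close> conjugates \<open>w\<close>, the scalar below is \<open>v\<^sup>* M v\<close>.\<close>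

definition pos_semidef_mat :: "complex mat \<Rightarrow> bool" where
  "pos_semidef_mat M \<longleftrightarrow> square_mat M \<and> mat_adjoint M = M \<and>
     (\<forall>v \<in> carrier_vec (dim_row M). 0 \<le> (M *\<^sub>v v) \<bullet>c v)"

text \<open>The indices \<open>i, j\<close> start at 0, so \<open>r = i + 1\<close> and \<open>s = j + 1\<close>.\<close>

definition C6 :: "complex mat" where
  "C6 = mat 6 6 (\<lambda>(i, j). if (i + 1) + (j + 1) = 7 then (-1) ^ (i + 1) else 0)"

definition C3 :: "complex mat" where
  "C3 = mat_of_rows_list 3
     [[ 0, 0, -1],
      [ 0, 1,  0],
      [-1, 0,  0]]"

definition Z :: "complex mat" where
  "Z = complex_of_real (1 / sqrt 2) \<cdot>\<^sub>m
     (let H = four_block_mat (1\<^sub>m 3) (1\<^sub>m 3) (1\<^sub>m 3) (- 1\<^sub>m 3)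
      in diag_block_mat [H, H] * diag_block_mat [1\<^sub>m 3, \<i> \<cdot>\<^sub>m C3, 1\<^sub>m 3, \<i> \<cdot>\<^sub>m C3])"

text \<open>The boundary conditions \<open>A Y(a) + B Y(b) = 0\<close> are represented by the pair \<open>(A, B)\<close> of
  6 by 6 matrices; their type is determined by \<open>r\<close>, where \<open>rank A = rank B = 3 + r\<close>.\<close>

definition bc_ranks :: "complex mat \<Rightarrow> complex mat \<Rightarrow> nat \<Rightarrow> bool" where
  "bc_ranks A B r \<longleftrightarrow> vec_space.rank 6 A = 3 + r \<and> vec_space.rank 6 B = 3 + r"

definition separated_bc :: "complex mat \<Rightarrow> complex mat \<Rightarrow> bool" where
  "separated_bc A B \<longleftrightarrow> bc_ranks A B 0"

definition mixed_bc :: "complex mat \<Rightarrow> complex mat \<Rightarrow> bool" where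
  "mixed_bc A B \<longleftrightarrow> (\<exists>r \<in> {1, 2}. bc_ranks A B r)"

definition coupled_bc :: "complex mat \<Rightarrow> complex mat \<Rightarrow> bool" where
  "coupled_bc A B \<longleftrightarrow> bc_ranks A B 3"

end

theory Submission
  imports Defs "Jordan_Normal_Form.Spectral_Radius"
begin

text \<open>The self-adjointness condition \<open>A C6 A\<^sup>* = B C6 B\<^sup>*\<close> equates
two compressions of the form \<open>C6\<close>, where \<open>\<i> C6\<close> is Hermitian of
signature (3, 3). The matrix \<^const>\<open>Z\<close> is block diagonal with two equal unitary
blocks, and each block diagonalises \<open>C6\<close> to \<open>-\<i> diag(I, -I)\<close>. Writing
\<open>(A:B) = (P:Q:R:T) Z\<close> with four blocks of three columns, the condition becomes \<open>P
P\<^sup>* - Q Q\<^sup>* = R R\<^sup>* - T T\<^sup>*\<close>, and moving the negative terms across,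
\<open>G G\<^sup>* = H H\<^sup>*\<close> for the square matrices \<open>G = (P:T)\<close> and
\<open>H = (Q:R)\<close>.

Because \<open>(A:B)\<close> has full row rank, \<open>H\<close> is invertible, and so \<open>G = H
K\<close> with \<open>K\<close> unitary: the boundary conditions are a unitary relation between the
positive and the negative part of the form. The parameters \<open>U1, U2, V1, V2, C, S\<close> are
those of the cosine-sine decomposition (\<open>cs_decomposition\<close>) of \<open>K\<close>, in
which \<open>S\<close> measures the coupling between the two endpoints;
\<open>cs_normal_form\<close> carries out this step in any dimension.

The cosine-sine decomposition in turn rests on the singular value decomposition
(\<open>singular_value_decomposition\<close>), proved by deflation from the existence of an
eigenvector of \<open>X\<^sup>* X\<close>, and on the fact that a matrix with Gram matrix
\<open>S\<^sup>2\<close>, for a nonnegative diagonal \<open>S\<close>, is \<open>S\<close> up to a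
unitary factor on the left (\<open>polar_diagonal\<close>).

For the classification, \<open>A\<close> and \<open>B\<close> are, up to invertible factors on both
sides, the two halves of the middle matrix. Eliminating \<open>C\<close> with the identity block
shows that each has rank \<open>3 + rank S\<close> (\<open>rank_cs_block\<close>), so the number
\<open>r\<close> that defines the type is the rank of \<open>S\<close>.\<close>

section \<open>Adjoints, unitary matrices and diagonal matrices\<close>

lemma mat_adjoint_eq: "mat_adjoint A = map_mat conjugate (transpose_mat A)"
  by (rule eq_matI) (auto simp: mat_adjoint_def mat_of_rows_def)

lemma mat_adjoint_carrier [simp]:
  "A \<in> carrier_mat n m \<Longrightarrow> mat_adjoint A \<in> carrier_mat m n"
  by (simp add: mat_adjoint_eq)

lemma mat_adjoint_dim [simp]:
  "dim_row (mat_adjoint A) = dim_col A" "dim_col (mat_adjoint A) = dim_row A"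
  by (simp_all add: mat_adjoint_eq)

lemma mat_adjoint_index [simp]:
  "i < dim_col A \<Longrightarrow> j < dim_row A \<Longrightarrow> mat_adjoint A $$ (i, j) = conjugate (A $$ (j, i))"
  by (simp add: mat_adjoint_eq)

lemma mat_adjoint_adjoint [simp]: "mat_adjoint (mat_adjoint A) = A"
  by (rule eq_matI) auto

lemma mat_adjoint_mult:
  fixes A :: "complex mat"
  assumes "A \<in> carrier_mat n m" and "B \<in> carrier_mat m k"
  shows "mat_adjoint (A * B) = mat_adjoint B * mat_adjoint A"
  using assms by (intro eq_matI) (auto simp: scalar_prod_def intro!: sum.cong)

lemma mat_adjoint_add:
  fixes A :: "complex mat"
  assumes "A \<in> carrier_mat n m" and "B \<in> carrier_mat n m"
  shows "mat_adjoint (A + B) = mat_adjoint A + mat_adjoint B"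
  using assms by (intro eq_matI) auto

lemma mat_adjoint_uminus: "mat_adjoint (- A :: complex mat) = - mat_adjoint A"
  by (rule eq_matI) auto

lemma mat_adjoint_smult: "mat_adjoint (c \<cdot>\<^sub>m A :: complex mat) = cnj c \<cdot>\<^sub>m mat_adjoint A"
  by (rule eq_matI) auto

lemma mat_adjoint_one [simp]: "mat_adjoint (1\<^sub>m n :: complex mat) = 1\<^sub>m n"
  by (rule eq_matI) auto

lemma mat_adjoint_zero [simp]: "mat_adjoint (0\<^sub>m n m :: complex mat) = 0\<^sub>m m n"
  by (rule eq_matI) auto

lemma mat_adjoint_four_block:
  fixes A :: "complex mat"
  assumes "A \<in> carrier_mat n1 m1" "B \<in> carrier_mat n1 m2"
    "C \<in> carrier_mat n2 m1" "D \<in> carrier_mat n2 m2"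
  shows "mat_adjoint (four_block_mat A B C D) =
    four_block_mat (mat_adjoint A) (mat_adjoint C) (mat_adjoint B) (mat_adjoint D)"
  using assms by (intro eq_matI) auto

lemma sprod_mat_adjoint:
  fixes A :: "complex mat"
  assumes A: "A \<in> carrier_mat n m" and v: "v \<in> carrier_vec m" and w: "w \<in> carrier_vec n"
  shows "(A *\<^sub>v v) \<bullet>c w = v \<bullet>c (mat_adjoint A *\<^sub>v w)"
proof -
  have "(A *\<^sub>v v) \<bullet>c w = (\<Sum>i<n. \<Sum>j<m. A $$ (i, j) * v $ j * cnj (w $ i))"
    using assms by (auto simp: scalar_prod_def sum_distrib_right atLeast0LessThan intro!: sum.cong)
  also have "\<dots> = (\<Sum>j<m. \<Sum>i<n. A $$ (i, j) * v $ j * cnj (w $ i))"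
    by (rule sum.swap)
  also have "\<dots> = v \<bullet>c (mat_adjoint A *\<^sub>v w)"
    using assms
    by (auto simp: scalar_prod_def sum_distrib_left atLeast0LessThan mult_ac intro!: sum.cong)
  finally show ?thesis .
qed

lemma unitary_matI:
  assumes "U \<in> carrier_mat n n" and "mat_adjoint U * U = 1\<^sub>m n"
  shows "unitary_mat U"
  using assms mat_mult_left_right_inverse[of "mat_adjoint U" n U]
  by (auto simp: unitary_mat_def inverts_mat_def)

lemma unitary_matD:
  assumes "unitary_mat U" and "U \<in> carrier_mat n n"
  shows "mat_adjoint U * U = 1\<^sub>m n" and "U * mat_adjoint U = 1\<^sub>m n"
  using assms by (auto simp: unitary_mat_def inverts_mat_def)

lemma unitary_mat_adjoint: "unitary_mat U \<Longrightarrow> unitary_mat (mat_adjoint U)"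
  by (auto simp: unitary_mat_def)

lemma unitary_mat_mult:
  assumes "unitary_mat U" "unitary_mat V" and U: "U \<in> carrier_mat n n" and V: "V \<in> carrier_mat n n"
  shows "unitary_mat (U * V)"
proof (rule unitary_matI)
  have "mat_adjoint (U * V) * (U * V) = mat_adjoint V * ((mat_adjoint U * U) * V)"
    using U V by (simp add: mat_adjoint_mult[of _ n n _ n] assoc_mult_mat[of _ n n _ n _ n])
  then show "mat_adjoint (U * V) * (U * V) = 1\<^sub>m n"
    using assms by (simp add: unitary_matD)
qed (use U V in auto)

lemma unitary_mat_one: "unitary_mat (1\<^sub>m n)"
  by (rule unitary_matI) auto

lemma unitary_mat_diag_block:
  assumes "unitary_mat U" "unitary_mat V" and U: "U \<in> carrier_mat n n" and V: "V \<in> carrier_mat m m"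
  shows "unitary_mat (four_block_mat U (0\<^sub>m n m) (0\<^sub>m m n) V)"
proof (rule unitary_matI)
  show "mat_adjoint (four_block_mat U (0\<^sub>m n m) (0\<^sub>m m n) V) * four_block_mat U (0\<^sub>m n m) (0\<^sub>m m n) V
    = 1\<^sub>m (n + m)"
    using assms
    by (simp add: mat_adjoint_four_block[of _ n n _ m _ m] mult_four_block_mat[of _ n n _ m _ m _ _ n _ m] unitary_matD)
qed (use U V in auto)

lemma diagonal_mat_adjoint_real:
  fixes D :: "complex mat"
  assumes "D \<in> carrier_mat n n" "diagonal_mat D" "\<And>i. i < n \<Longrightarrow> D $$ (i, i) \<in> \<real>"
  shows "mat_adjoint D = D"
  using assms by (intro eq_matI) (auto simp: diagonal_mat_def Reals_cnj_iff, metis complex_cnj_zero)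

lemma diagonal_mat_mult_index:
  fixes D :: "'a :: comm_ring_1 mat"
  assumes "D \<in> carrier_mat n n" "diagonal_mat D" "A \<in> carrier_mat n m" "i < n" "j < m"
  shows "(D * A) $$ (i, j) = D $$ (i, i) * A $$ (i, j)"
proof -
  have "(D * A) $$ (i, j) = (\<Sum>k\<in>{0..<n}. D $$ (i, k) * A $$ (k, j))"
    using assms by (auto simp: scalar_prod_def)
  also have "\<dots> = (\<Sum>k\<in>{0..<n}. if k = i then D $$ (i, i) * A $$ (i, j) else 0)"
    using assms by (intro sum.cong) (auto simp: diagonal_mat_def)
  finally show ?thesis using assms by simp
qed

lemma mult_diagonal_mat_index:
  fixes D :: "'a :: comm_ring_1 mat"
  assumes "D \<in> carrier_mat m m" "diagonal_mat D" "A \<in> carrier_mat n m" "i < n" "j < m"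
  shows "(A * D) $$ (i, j) = A $$ (i, j) * D $$ (j, j)"
proof -
  have "(A * D) $$ (i, j) = (\<Sum>k\<in>{0..<m}. A $$ (i, k) * D $$ (k, j))"
    using assms by (auto simp: scalar_prod_def)
  also have "\<dots> = (\<Sum>k\<in>{0..<m}. if k = j then A $$ (i, j) * D $$ (j, j) else 0)"
    using assms by (intro sum.cong) (auto simp: diagonal_mat_def)
  finally show ?thesis using assms by simp
qed

text \<open>The entrywise form of positive semidefiniteness for a diagonal matrix: the order on
\<^typ>\<open>complex\<close> makes \<open>0 \<le> D $$ (i, i)\<close> say that the entry is real as
well. Singular values, cosines and sines all appear as diagonals of this kind.\<close>

definition nonneg_diagonal :: "complex mat \<Rightarrow> bool" where
  "nonneg_diagonal D \<longleftrightarrow> diagonal_mat D \<and> (\<forall>i < dim_row D. 0 \<le> D $$ (i, i))"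

lemma nonneg_diagonal_adjoint:
  assumes "D \<in> carrier_mat n n" "nonneg_diagonal D"
  shows "mat_adjoint D = D"
  using assms by (intro diagonal_mat_adjoint_real[of _ n])
    (auto simp: nonneg_diagonal_def less_eq_complex_def complex_is_Real_iff)

lemma nonneg_diagonal_pos_semidef:
  assumes D: "D \<in> carrier_mat n n" and nn: "nonneg_diagonal D"
  shows "pos_semidef_mat D"
proof -
  have "0 \<le> (D *\<^sub>v v) \<bullet>c v" if v: "v \<in> carrier_vec n" for v
  proof -
    have "(D *\<^sub>v v) $ i = D $$ (i, i) * v $ i" if "i < n" for i
    proof -
      have "(D *\<^sub>v v) $ i = (\<Sum>k\<in>{0..<n}. D $$ (i, k) * v $ k)"
        using D v that by (auto simp: scalar_prod_def)
      also have "\<dots> = (\<Sum>k\<in>{0..<n}. if k = i then D $$ (i, i) * v $ i else 0)"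
        using D nn that by (intro sum.cong) (auto simp: nonneg_diagonal_def diagonal_mat_def)
      finally show ?thesis using that by simp
    qed
    then have "(D *\<^sub>v v) \<bullet>c v = (\<Sum>i\<in>{0..<n}. D $$ (i, i) * (v $ i * cnj (v $ i)))"
      using D v by (auto simp: scalar_prod_def intro!: sum.cong)
    also have "\<dots> \<ge> 0"
    proof (rule sum_nonneg, rule mult_nonneg_nonneg)
      show "0 \<le> v $ i * cnj (v $ i)" for i
        using conjugate_square_positive[of "v $ i"] by simp
    qed (use D nn in \<open>auto simp: nonneg_diagonal_def\<close>)
    finally show ?thesis .
  qed
  then show ?thesis
    using D nonneg_diagonal_adjoint[OF D nn] by (auto simp: pos_semidef_mat_def)
qed

lemma four_block_mat_inject:
  assumes "four_block_mat A B C D = four_block_mat A' B' C' D'"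
    "A \<in> carrier_mat n1 m1" "B \<in> carrier_mat n1 m2" "C \<in> carrier_mat n2 m1" "D \<in> carrier_mat n2 m2"
    "A' \<in> carrier_mat n1 m1" "B' \<in> carrier_mat n1 m2" "C' \<in> carrier_mat n2 m1" "D' \<in> carrier_mat n2 m2"
  shows "A = A' \<and> B = B' \<and> C = C' \<and> D = D'"
proof -
  have e: "four_block_mat A B C D $$ (i, j) = four_block_mat A' B' C' D' $$ (i, j)" for i j
    by (simp add: assms(1))
  have "A $$ (i, j) = A' $$ (i, j)" if "i < n1" "j < m1" for i j
    using e[of i j] that assms(2-) by simp
  moreover have "B $$ (i, j) = B' $$ (i, j)" if "i < n1" "j < m2" for i j
    using e[of i "j + m1"] that assms(2-) by simp
  moreover have "C $$ (i, j) = C' $$ (i, j)" if "i < n2" "j < m1" for i j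
    using e[of "i + n1" j] that assms(2-) by simp
  moreover have "D $$ (i, j) = D' $$ (i, j)" if "i < n2" "j < m2" for i j
    using e[of "i + n1" "j + m1"] that assms(2-) by simp
  ultimately show ?thesis
    using assms(2-) by (auto intro!: eq_matI)
qed

section \<open>Singular value decomposition\<close>

lemma vec_normalize:
  fixes v :: "complex vec"
  assumes v: "v \<in> carrier_vec n" and v0: "v \<noteq> 0\<^sub>v n"
  obtains r where "r > 0" "v \<bullet>c v = of_real (r\<^sup>2)"
    "(of_real (1 / r) \<cdot>\<^sub>v v) \<bullet>c (of_real (1 / r) \<cdot>\<^sub>v v) = 1"
proof -
  have "v \<bullet>c v > 0" using v v0 by simp
  then have q: "Re (v \<bullet>c v) > 0" "v \<bullet>c v = of_real (Re (v \<bullet>c v))"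
    by (auto simp: less_complex_def complex_eq_iff)
  define r where "r = sqrt (Re (v \<bullet>c v))"
  have r: "r > 0" "v \<bullet>c v = of_real (r\<^sup>2)" using q by (auto simp: r_def)
  have "(of_real (1 / r) \<cdot>\<^sub>v v) \<bullet>c (of_real (1 / r) \<cdot>\<^sub>v v) = of_real (1 / r) * (of_real (1 / r) * (v \<bullet>c v))"
    using v by (simp add: conjugate_smult_vec)
  also have "\<dots> = 1" using r(1) unfolding r(2) by (simp add: power2_eq_square)
  finally show thesis using that r by blast
qed

text \<open>Completing \<open>v\<close> to a basis and orthogonalising keeps \<open>v\<close> as the
first vector; dividing each vector by its norm then gives orthonormal columns, and leaves
\<open>v\<close> alone because it has norm 1 already.\<close>

lemma unit_vec_extends_to_unitary:
  fixes v :: "complex vec"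
  assumes v: "v \<in> carrier_vec n" and unit: "v \<bullet>c v = 1"
  obtains U where "U \<in> carrier_mat n n" "unitary_mat U" "col U 0 = v"
proof -
  interpret cof_vec_space n "TYPE(complex)" .
  have v0: "v \<noteq> 0\<^sub>v n" using unit v by auto
  have n: "n > 0" using v0 v by (cases n) auto
  define ws where "ws = gram_schmidt n (basis_completion v)"
  note bc = basis_completion[OF v v0]
  note gs = gram_schmidt_result[OF bc(2,4,5) ws_def]
  have hd: "hd ws = v"
    using bc(6,7) n v unfolding ws_def by (cases "basis_completion v") auto
  have len: "length ws = n" using gs bc by simp
  have ws: "ws ! i \<in> carrier_vec n" if "i < n" for i using that gs(3) len by auto
  have ex: "\<exists>r. r > 0 \<and> ws ! i \<bullet>c ws ! i = of_real (r\<^sup>2)" if "i < n" for i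
  proof -
    have "ws ! i \<bullet>c ws ! i \<noteq> 0" using corthogonalD[OF gs(2)] that len by auto
    then have "ws ! i \<noteq> 0\<^sub>v n" using ws[OF that] by auto
    then show ?thesis using vec_normalize[OF ws[OF that]] by metis
  qed
  then obtain r where r: "\<And>i. i < n \<Longrightarrow> r i > 0 \<and> ws ! i \<bullet>c ws ! i = of_real ((r i)\<^sup>2)" by metis
  define U where "U = mat n n (\<lambda>(i, j). of_real (1 / r j) * ws ! j $ i)"
  have U: "U \<in> carrier_mat n n" by (simp add: U_def)
  have "mat_adjoint U * U = 1\<^sub>m n"
  proof (rule eq_matI)
    fix i j assume "i < dim_row (1\<^sub>m n :: complex mat)" "j < dim_col (1\<^sub>m n :: complex mat)"
    then have ij: "i < n" "j < n" by auto
    have "(mat_adjoint U * U) $$ (i, j) = of_real (1 / r i) * of_real (1 / r j) * (ws ! j \<bullet>c ws ! i)"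
      using U ij ws[of i] ws[of j]
      by (auto simp: scalar_prod_def U_def sum_distrib_left intro!: sum.cong)
    also have "\<dots> = (if i = j then 1 else 0)"
      using r[of i] ij corthogonalD[OF gs(2), of j i] len by (auto simp: power2_eq_square)
    finally show "(mat_adjoint U * U) $$ (i, j) = 1\<^sub>m n $$ (i, j)" using ij by simp
  qed (use U in auto)
  then have "unitary_mat U" using U by (intro unitary_matI)
  moreover have "ws ! 0 = v" using hd len n by (cases ws) auto
  moreover have "r 0 = 1"
  proof -
    have "of_real ((r 0)\<^sup>2) = (1 :: complex)" using r[OF n] unit \<open>ws ! 0 = v\<close> by simp
    then have "(r 0)\<^sup>2 = 1" using of_real_eq_1_iff by blast
    then show ?thesis using r[OF n] by (simp add: power2_eq_1_iff)
  qed
  ultimately have "col U 0 = v" using n v by (intro eq_vecI) (auto simp: U_def)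
  with \<open>unitary_mat U\<close> show thesis using that U by blast
qed

text \<open>Phrased through the kernel of the adjoint, because this is what the two applications
speak about: a singular square matrix has to supply a vector killed by its adjoint, and an identity
of the form \<open>G G\<^sup>* = H H\<^sup>*\<close> compares kernels of adjoints.\<close>

lemma adjoint_kernel_trivial_imp_inverse:
  fixes X :: "complex mat"
  assumes X: "X \<in> carrier_mat n n"
    and ker: "\<And>w. w \<in> carrier_vec n \<Longrightarrow> mat_adjoint X *\<^sub>v w = 0\<^sub>v n \<Longrightarrow> w = 0\<^sub>v n"
  obtains Y where "Y \<in> carrier_mat n n" "Y * X = 1\<^sub>m n" "X * Y = 1\<^sub>m n"
proof -
  have Xa: "mat_adjoint X \<in> carrier_mat n n" using X by simp
  have "det (mat_adjoint X) \<noteq> 0" using det_0_iff_vec_prod_zero_field[OF Xa] ker by blast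
  then obtain Y where Y: "Y \<in> carrier_mat n n" "mat_adjoint X * Y = 1\<^sub>m n"
    using det_non_zero_imp_unit[OF Xa] unfolding Units_def ring_mat_def by auto
  then have "mat_adjoint Y * X = 1\<^sub>m n"
    using mat_adjoint_mult[of "mat_adjoint X" n n Y n] X by simp
  then show thesis
    using that[of "mat_adjoint Y"] mat_mult_left_right_inverse[of "mat_adjoint Y" n X] X Y by simp
qed

text \<open>An eigenvector \<open>v\<close> of \<open>X\<^sup>* X\<close> is a right singular
vector, and \<open>X v\<close>, normalised, is the left one. This breaks down when \<open>X v =
0\<close>; then \<open>X\<close> is singular, so \<open>X\<^sup>*\<close> has a kernel, and any unit
vector from it serves as \<open>u\<close> with singular value 0. The symmetric pair of equations in
the conclusion is what makes the row and the column of the transformed matrix vanish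
together.\<close>

lemma singular_pair_exists:
  fixes X :: "complex mat"
  assumes X: "X \<in> carrier_mat n n" and n: "n > 0"
  obtains u v \<sigma> where "u \<in> carrier_vec n" "v \<in> carrier_vec n" "u \<bullet>c u = 1" "v \<bullet>c v = 1" "\<sigma> \<ge> (0 :: real)"
    "X *\<^sub>v v = of_real \<sigma> \<cdot>\<^sub>v u" "mat_adjoint X *\<^sub>v u = of_real \<sigma> \<cdot>\<^sub>v v"
proof -
  have Xa: "mat_adjoint X \<in> carrier_mat n n" using X by simp
  have M: "mat_adjoint X * X \<in> carrier_mat n n" by (rule mult_carrier_mat[OF Xa X])
  obtain l where "eigenvalue (mat_adjoint X * X) l"
    using spectrum_non_empty[OF M n] by (auto simp: spectrum_def)
  then obtain v0 where v0: "v0 \<in> carrier_vec n" "v0 \<noteq> 0\<^sub>v n" "(mat_adjoint X * X) *\<^sub>v v0 = l \<cdot>\<^sub>v v0"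
    using M unfolding eigenvalue_def eigenvector_def by auto
  obtain r where r: "r > 0" "(of_real (1 / r) \<cdot>\<^sub>v v0) \<bullet>c (of_real (1 / r) \<cdot>\<^sub>v v0) = 1"
    using vec_normalize[OF v0(1,2)] by metis
  define v where "v = complex_of_real (1 / r) \<cdot>\<^sub>v v0"
  have v: "v \<in> carrier_vec n" "v \<bullet>c v = 1" using v0 r by (auto simp: v_def)
  have ev: "mat_adjoint X *\<^sub>v (X *\<^sub>v v) = l \<cdot>\<^sub>v v"
  proof -
    have "mat_adjoint X *\<^sub>v (X *\<^sub>v v) = (mat_adjoint X * X) *\<^sub>v v"
      using assoc_mult_mat_vec[OF Xa X v(1)] by simp
    also have "\<dots> = of_real (1 / r) \<cdot>\<^sub>v ((mat_adjoint X * X) *\<^sub>v v0)"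
      using M v0 unfolding v_def by (simp add: mult_mat_vec)
    also have "\<dots> = l \<cdot>\<^sub>v v" unfolding v0(3) v_def by (simp add: smult_smult_assoc mult.commute)
    finally show ?thesis .
  qed
  have Xv: "X *\<^sub>v v \<in> carrier_vec n" using X v by simp
  have norm: "(X *\<^sub>v v) \<bullet>c (X *\<^sub>v v) = cnj l"
  proof -
    have "(X *\<^sub>v v) \<bullet>c (X *\<^sub>v v) = v \<bullet>c (l \<cdot>\<^sub>v v)"
      using sprod_mat_adjoint[OF X v(1) Xv] ev by simp
    then show ?thesis using v by (simp add: conjugate_smult_vec)
  qed
  show thesis
  proof (cases "X *\<^sub>v v = 0\<^sub>v n")
    case False
    obtain s where s: "s > 0" "(X *\<^sub>v v) \<bullet>c (X *\<^sub>v v) = of_real (s\<^sup>2)"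
      "(of_real (1 / s) \<cdot>\<^sub>v (X *\<^sub>v v)) \<bullet>c (of_real (1 / s) \<cdot>\<^sub>v (X *\<^sub>v v)) = 1"
      using vec_normalize[OF Xv False] by metis
    have l: "l = of_real (s\<^sup>2)" using norm s(2) by (metis complex_cnj_cnj complex_cnj_complex_of_real)
    define u where "u = complex_of_real (1 / s) \<cdot>\<^sub>v (X *\<^sub>v v)"
    have u: "u \<in> carrier_vec n" using Xv by (simp add: u_def)
    have Xvu: "X *\<^sub>v v = of_real s \<cdot>\<^sub>v u" using s(1) Xv by (simp add: u_def smult_smult_assoc)
    have Xuv: "mat_adjoint X *\<^sub>v u = of_real s \<cdot>\<^sub>v v"
    proof -
      have "mat_adjoint X *\<^sub>v u = of_real (1 / s) \<cdot>\<^sub>v (l \<cdot>\<^sub>v v)"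
        using Xa Xv ev unfolding u_def by (simp add: mult_mat_vec)
      then show ?thesis using s(1) by (simp add: l smult_smult_assoc power2_eq_square)
    qed
    have "u \<bullet>c u = 1" using s(3) by (simp only: u_def)
    from that[OF u v(1) this v(2) _ Xvu Xuv] s(1) show thesis by simp
  next
    case True
    have "v \<noteq> 0\<^sub>v n" using v by auto
    have "\<exists>u. u \<in> carrier_vec n \<and> u \<noteq> 0\<^sub>v n \<and> mat_adjoint X *\<^sub>v u = 0\<^sub>v n"
    proof (rule ccontr)
      assume "\<not> ?thesis"
      then obtain Y where Y: "Y \<in> carrier_mat n n" "Y * X = 1\<^sub>m n"
        using adjoint_kernel_trivial_imp_inverse[OF X] by metis
      then have "v = Y *\<^sub>v (X *\<^sub>v v)"
        using assoc_mult_mat_vec[OF Y(1) X v(1)] v(1) by simp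
      then have "v = 0\<^sub>v n" using True Y by auto
      with \<open>v \<noteq> 0\<^sub>v n\<close> show False ..
    qed
    then obtain u0 where u0: "u0 \<in> carrier_vec n" "u0 \<noteq> 0\<^sub>v n" "mat_adjoint X *\<^sub>v u0 = 0\<^sub>v n" by blast
    obtain s where s: "(of_real (1 / s) \<cdot>\<^sub>v u0) \<bullet>c (of_real (1 / s) \<cdot>\<^sub>v u0) = 1"
      using vec_normalize[OF u0(1,2)] by metis
    have "mat_adjoint X *\<^sub>v (complex_of_real (1 / s) \<cdot>\<^sub>v u0) = 0\<^sub>v n"
      using u0 Xa by (intro eq_vecI) (auto simp: mult_mat_vec)
    with True s u0 v show thesis
      by (intro that[of "complex_of_real (1 / s) \<cdot>\<^sub>v u0" v 0]) auto
  qed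
qed

lemmas square_mat_algebra =
  assoc_mult_mat[of _ n n _ n _ n] mult_carrier_mat[of _ n n _ n] add_carrier_mat[of _ n n]
  mat_adjoint_mult[of _ n n _ n]
  add_mult_distrib_mat[of _ n n _ _ n] mult_add_distrib_mat[of _ n n _ n] for n

text \<open>Deflation: unitary matrices with first columns \<open>u\<close> and \<open>v\<close>, a
singular pair of \<open>X\<close>, turn \<open>X\<close> into a matrix whose first row and first
column are zero off the diagonal. The remaining block is handled by induction.\<close>

theorem singular_value_decomposition:
  fixes X :: "complex mat"
  assumes "X \<in> carrier_mat n n"
  shows "\<exists>U D V. U \<in> carrier_mat n n \<and> D \<in> carrier_mat n n \<and> V \<in> carrier_mat n n \<and>
    unitary_mat U \<and> nonneg_diagonal D \<and> unitary_mat V \<and> X = U * D * V"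
  using assms
proof (induction n arbitrary: X)
  case 0
  then have "X = 1\<^sub>m 0 * 1\<^sub>m 0 * 1\<^sub>m 0" by (intro eq_matI) auto
  moreover have "nonneg_diagonal (1\<^sub>m 0)" by (simp add: nonneg_diagonal_def diagonal_mat_def)
  ultimately show ?case using unitary_mat_one[of 0] one_carrier_mat[of 0] by blast
next
  case (Suc n)
  note X = Suc.prems
  note sq = square_mat_algebra[where n = "Suc n"]
  obtain u v \<sigma> where uv: "u \<in> carrier_vec (Suc n)" "v \<in> carrier_vec (Suc n)" "u \<bullet>c u = 1" "v \<bullet>c v = 1"
    and \<sigma>: "\<sigma> \<ge> (0 :: real)"
    and Xv: "X *\<^sub>v v = of_real \<sigma> \<cdot>\<^sub>v u" and Xu: "mat_adjoint X *\<^sub>v u = of_real \<sigma> \<cdot>\<^sub>v v"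
    using singular_pair_exists[OF X] by blast
  obtain P where P: "P \<in> carrier_mat (Suc n) (Suc n)" "unitary_mat P" "col P 0 = u"
    using unit_vec_extends_to_unitary uv by metis
  obtain Q where Q: "Q \<in> carrier_mat (Suc n) (Suc n)" "unitary_mat Q" "col Q 0 = v"
    using unit_vec_extends_to_unitary uv by metis
  \<comment> \<open>Stated for arbitrary matrices, as it serves for the first column (with
    \<open>X\<close>) and, by taking adjoints, for the first row.\<close>
  have col0: "col (mat_adjoint P' * X' * Q') 0 = of_real \<sigma> \<cdot>\<^sub>v unit_vec (Suc n) 0"
    if P': "P' \<in> carrier_mat (Suc n) (Suc n)" "unitary_mat P'"
      and Q': "Q' \<in> carrier_mat (Suc n) (Suc n)" and X': "X' \<in> carrier_mat (Suc n) (Suc n)"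
      and sing: "X' *\<^sub>v col Q' 0 = of_real \<sigma> \<cdot>\<^sub>v col P' 0" for P' Q' X'
  proof -
    have c: "col P' 0 \<in> carrier_vec (Suc n)" "col Q' 0 \<in> carrier_vec (Suc n)"
      using P' Q' by (auto intro: col_carrier_vec)
    have "col (mat_adjoint P' * X' * Q') 0 = (mat_adjoint P' * X') *\<^sub>v col Q' 0"
      by (rule col_mult2[OF mult_carrier_mat[OF mat_adjoint_carrier[OF P'(1)] X'] Q']) simp
    also have "\<dots> = mat_adjoint P' *\<^sub>v (X' *\<^sub>v col Q' 0)"
      by (rule assoc_mult_mat_vec[OF mat_adjoint_carrier[OF P'(1)] X' c(2)])
    also have "\<dots> = of_real \<sigma> \<cdot>\<^sub>v (mat_adjoint P' *\<^sub>v col P' 0)"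
      using P' c by (simp add: sing mult_mat_vec[of _ "Suc n" "Suc n"])
    also have "mat_adjoint P' *\<^sub>v col P' 0 = col (mat_adjoint P' * P') 0"
      using P' by (simp add: col_mult2[of _ "Suc n" "Suc n" _ "Suc n"])
    also have "\<dots> = unit_vec (Suc n) 0" by (simp add: unitary_matD[OF P'(2,1)])
    finally show ?thesis .
  qed
  define Y where "Y = mat_adjoint P * X * Q"
  have Y: "Y \<in> carrier_mat (Suc n) (Suc n)" using P Q X by (simp add: Y_def sq)
  have Ya: "mat_adjoint Y = mat_adjoint Q * mat_adjoint X * P"
    using P Q X by (simp add: Y_def sq)
  have Y0: "Y $$ (i, 0) = (if i = 0 then of_real \<sigma> else 0)" if "i < Suc n" for i
  proof -
    have "Y $$ (i, 0) = col Y 0 $ i" using Y that by simp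
    also have "\<dots> = (if i = 0 then of_real \<sigma> else 0)"
      unfolding Y_def using col0[OF P(1,2) Q(1) X] that by (simp add: P Q Xv)
    finally show ?thesis .
  qed
  have Y0': "Y $$ (0, j) = (if j = 0 then of_real \<sigma> else 0)" if "j < Suc n" for j
  proof -
    have "Y $$ (0, j) = cnj (col (mat_adjoint Y) 0 $ j)" using Y that by simp
    also have "\<dots> = (if j = 0 then of_real \<sigma> else 0)"
      unfolding Ya using col0[OF Q(1,2) P(1), of "mat_adjoint X"] X that by (simp add: P Q Xu)
    finally show ?thesis .
  qed
  define Y4 where "Y4 = mat n n (\<lambda>(i, j). Y $$ (Suc i, Suc j))"
  let ?s = "of_real \<sigma> \<cdot>\<^sub>m 1\<^sub>m 1 :: complex mat"
  let ?fb = "\<lambda>A B. four_block_mat A (0\<^sub>m 1 n) (0\<^sub>m n 1) B :: complex mat"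
  have Yb: "Y = ?fb ?s Y4"
    by (rule eq_matI) (use Y Y0 Y0' in \<open>auto simp: Y4_def\<close>)
  obtain U D V where UDV: "U \<in> carrier_mat n n" "D \<in> carrier_mat n n" "V \<in> carrier_mat n n"
    "unitary_mat U" "nonneg_diagonal D" "unitary_mat V" "Y4 = U * D * V"
    using Suc.IH[of Y4] by (auto simp: Y4_def)
  let ?U = "?fb (1\<^sub>m 1) U" and ?D = "?fb ?s D" and ?V = "?fb (1\<^sub>m 1) V"
  have UU: "?U \<in> carrier_mat (Suc n) (Suc n)" "unitary_mat ?U"
    using unitary_mat_diag_block[OF unitary_mat_one UDV(4) _ UDV(1), of 1]
      four_block_carrier_mat[OF one_carrier_mat[of 1] UDV(1)] by auto
  have VV: "?V \<in> carrier_mat (Suc n) (Suc n)" "unitary_mat ?V"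
    using unitary_mat_diag_block[OF unitary_mat_one UDV(6) _ UDV(3), of 1]
      four_block_carrier_mat[OF one_carrier_mat[of 1] UDV(3)] by auto
  have s1: "?s \<in> carrier_mat 1 1" by simp
  have DD: "?D \<in> carrier_mat (Suc n) (Suc n)"
    using four_block_carrier_mat[OF s1 UDV(2)] by simp
  have nn: "nonneg_diagonal ?D"
    using UDV(2,5) \<sigma> by (auto simp: nonneg_diagonal_def diagonal_mat_def less_eq_complex_def)
  have "?U * ?D * ?V = Y"
    using UDV by (simp add: Yb mult_four_block_mat[of _ 1 1 _ n _ n _ _ 1 _ n])
  then have "X = (P * ?U) * ?D * (?V * mat_adjoint Q)"
  proof -
    have "P * Y * mat_adjoint Q = (P * mat_adjoint P) * X * (Q * mat_adjoint Q)"
      using P Q X by (simp add: Y_def sq)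
    also have "\<dots> = X" using P Q X by (simp add: unitary_matD[of P "Suc n"] unitary_matD[of Q "Suc n"])
    finally have "X = P * (?U * ?D * ?V) * mat_adjoint Q" using \<open>?U * ?D * ?V = Y\<close> by simp
    then show ?thesis using P Q UU VV DD by (simp add: sq del: four_block_carrier_mat)
  qed
  moreover have "unitary_mat (P * ?U)" "unitary_mat (?V * mat_adjoint Q)"
    using P Q UU VV by (auto intro!: unitary_mat_mult[of _ _ "Suc n"] unitary_mat_adjoint)
  moreover have "P * ?U \<in> carrier_mat (Suc n) (Suc n)" "?V * mat_adjoint Q \<in> carrier_mat (Suc n) (Suc n)"
    using mult_carrier_mat[OF P(1) UU(1)] mult_carrier_mat[OF VV(1), of "mat_adjoint Q" "Suc n"] Q by auto
  ultimately show ?case using DD nn by blast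
qed

lemma nonneg_sq_eq_imp_eq:
  fixes a b :: complex
  assumes "0 \<le> a" "0 \<le> b" "a * a = b * b"
  shows "a = b"
proof -
  have "(a - b) * (a + b) = 0" using assms(3) by (simp add: algebra_simps)
  then have "a = b \<or> a = - b" by (auto simp: eq_neg_iff_add_eq_0)
  then show ?thesis using assms(1,2) by (auto simp: less_eq_complex_def complex_eq_iff)
qed

text \<open>A polar decomposition in the case that the positive factor is already diagonal. If
\<open>Y = P D Q\<close> is a singular value decomposition, then \<open>Q S\<^sup>2 = D\<^sup>2
Q\<close>, so \<open>Q\<close> only links indices at which the squares of \<open>D\<close> and
\<open>S\<close> agree. The entries being nonnegative, \<open>D\<close> and \<open>S\<close> agree
there too, hence \<open>Q S = D Q\<close> and \<open>Y = (P Q) S\<close>. This settles all zero and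
repeated diagonal entries at once.\<close>

lemma polar_diagonal:
  fixes Y S :: "complex mat"
  assumes Y: "Y \<in> carrier_mat n n" and S: "S \<in> carrier_mat n n" and nS: "nonneg_diagonal S"
    and eq: "mat_adjoint Y * Y = S * S"
  obtains W where "W \<in> carrier_mat n n" "unitary_mat W" "Y = W * S"
proof -
  note sq = square_mat_algebra[where n = n]
  obtain P D Q where svd: "P \<in> carrier_mat n n" "D \<in> carrier_mat n n" "Q \<in> carrier_mat n n"
    "unitary_mat P" "nonneg_diagonal D" "unitary_mat Q" "Y = P * D * Q"
    using singular_value_decomposition[OF Y] by blast
  note uP = unitary_matD[OF svd(4,1)] and uQ = unitary_matD[OF svd(6,3)]
  have "S * S = mat_adjoint Q * (D * ((mat_adjoint P * P) * (D * Q)))"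
    unfolding eq[symmetric] svd(7) using svd(1-3) nonneg_diagonal_adjoint[OF svd(2,5)] by (simp add: sq)
  then have "Q * (S * S) = (Q * mat_adjoint Q) * (D * (D * Q))"
    using svd(1-3) uP by (simp add: sq)
  then have QS: "Q * (S * S) = D * (D * Q)" using svd(1-3) uQ by (simp add: sq)
  have "D * Q = Q * S"
  proof (rule eq_matI)
    fix i j assume "i < dim_row (Q * S)" "j < dim_col (Q * S)"
    then have ij: "i < n" "j < n" using svd S by auto
    have dS: "diagonal_mat S" and dD: "diagonal_mat D" using nS svd by (auto simp: nonneg_diagonal_def)
    note L = diagonal_mat_mult_index[OF svd(2) dD _ ij(1)] and R = mult_diagonal_mat_index[OF S dS _ _ ij(2)]
    have "D $$ (i, i) * (D $$ (i, i) * Q $$ (i, j)) = Q $$ (i, j) * S $$ (j, j) * S $$ (j, j)"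
    proof -
      have "Q * (S * S) = (Q * S) * S" using svd(3) S by (simp add: sq)
      then have "(D * (D * Q)) $$ (i, j) = ((Q * S) * S) $$ (i, j)" using QS by simp
      then show ?thesis
        unfolding L[OF mult_carrier_mat[OF svd(2,3)] ij(2)] L[OF svd(3) ij(2)]
          R[OF mult_carrier_mat[OF svd(3) S] ij(1)] R[OF svd(3) ij(1)] .
    qed
    then have "Q $$ (i, j) = 0 \<or> D $$ (i, i) * D $$ (i, i) = S $$ (j, j) * S $$ (j, j)"
      by (auto simp: mult_ac)
    then have "Q $$ (i, j) = 0 \<or> D $$ (i, i) = S $$ (j, j)"
      using nonneg_sq_eq_imp_eq[of "D $$ (i, i)" "S $$ (j, j)"] ij nS svd S
      by (auto simp: nonneg_diagonal_def)
    then show "(D * Q) $$ (i, j) = (Q * S) $$ (i, j)"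
      unfolding L[OF svd(3) ij(2)] R[OF svd(3) ij(1)] by auto
  qed (use svd S in auto)
  then have "Y = (P * Q) * S" using svd S by (simp add: sq)
  then show thesis
    using that[of "P * Q"] unitary_mat_mult[OF svd(4,6,1,3)] mult_carrier_mat[OF svd(1,3)] by blast
qed

section \<open>Cosine-sine decomposition\<close>

lemma adjoint_mult_self_diag:
  fixes X :: "complex mat"
  assumes "X \<in> carrier_mat n m" "i < m"
  shows "0 \<le> (mat_adjoint X * X) $$ (i, i)"
proof -
  have "(mat_adjoint X * X) $$ (i, i) = (\<Sum>k\<in>{0..<n}. X $$ (k, i) * conjugate (X $$ (k, i)))"
    using assms by (auto simp: scalar_prod_def mult.commute intro!: sum.cong)
  also have "\<dots> \<ge> 0" by (intro sum_nonneg conjugate_square_positive)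
  finally show ?thesis .
qed

lemma diagonal_mat_sq_index:
  fixes D :: "complex mat"
  assumes "D \<in> carrier_mat n n" "diagonal_mat D" "i < n" "j < n"
  shows "(D * D) $$ (i, j) = (if i = j then D $$ (i, i) * D $$ (i, i) else 0)"
  using diagonal_mat_mult_index[OF assms(1,2,1,3,4)] assms by (auto simp: diagonal_mat_def)

lemma diagonal_mat_commute:
  fixes C S :: "complex mat"
  assumes "C \<in> carrier_mat n n" "diagonal_mat C" "S \<in> carrier_mat n n" "diagonal_mat S"
  shows "C * S = S * C"
proof (rule eq_matI)
  fix i j assume "i < dim_row (S * C)" "j < dim_col (S * C)"
  then have ij: "i < n" "j < n" using assms by auto
  show "(C * S) $$ (i, j) = (S * C) $$ (i, j)"
    unfolding diagonal_mat_mult_index[OF assms(1,2,3) ij] mult_diagonal_mat_index[OF assms(1,2,3) ij]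
    using assms ij by (auto simp: diagonal_mat_def)
qed (use assms in auto)

text \<open>The diagonal of \<open>Y\<^sup>* Y\<close> consists of squared column norms, so \<open>1
- c\<^sup>2\<close> is nonnegative for each diagonal entry \<open>c\<close> of \<open>C\<close> and
has a real square root.\<close>

lemma complementary_diagonal_exists:
  assumes C: "C \<in> carrier_mat n n" "nonneg_diagonal C"
    and Y: "Y \<in> carrier_mat m n" and eq: "C * C + mat_adjoint Y * Y = 1\<^sub>m n"
  obtains S where "S \<in> carrier_mat n n" "nonneg_diagonal S" "mat_adjoint Y * Y = S * S"
proof -
  define S where "S = mat n n (\<lambda>(i, j). if i = j then of_real (sqrt (1 - (Re (C $$ (i, i)))\<^sup>2)) else 0 :: complex)"
  have S: "S \<in> carrier_mat n n" by (simp add: S_def)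
  have dC: "diagonal_mat C" using C by (simp add: nonneg_diagonal_def)
  have dS: "diagonal_mat S" by (simp add: S_def diagonal_mat_def)
  have key: "(mat_adjoint Y * Y) $$ (i, j) = (if i = j then of_real (1 - (Re (C $$ (i, i)))\<^sup>2) else 0)"
    if ij: "i < n" "j < n" for i j
  proof -
    have "C $$ (i, i) \<ge> 0" using C ij by (auto simp: nonneg_diagonal_def)
    then have Ci: "C $$ (i, i) * C $$ (i, i) = of_real ((Re (C $$ (i, i)))\<^sup>2)"
      by (auto simp: less_eq_complex_def complex_eq_iff power2_eq_square)
    have "(C * C + mat_adjoint Y * Y) $$ (i, j) = (C * C) $$ (i, j) + (mat_adjoint Y * Y) $$ (i, j)"
      using Y ij by (intro index_add_mat) auto
    then have "(mat_adjoint Y * Y) $$ (i, j) = (if i = j then 1 else 0) - (C * C) $$ (i, j)"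
      using ij by (simp add: eq)
    then show ?thesis using Ci unfolding diagonal_mat_sq_index[OF C(1) dC ij] by auto
  qed
  have le: "0 \<le> 1 - (Re (C $$ (i, i)))\<^sup>2" if "i < n" for i
    using adjoint_mult_self_diag[OF Y that] unfolding key[OF that that] by (simp add: less_eq_complex_def)
  have "nonneg_diagonal S"
    using dS le by (auto simp: nonneg_diagonal_def S_def less_eq_complex_def)
  moreover have "mat_adjoint Y * Y = S * S"
  proof (rule eq_matI)
    fix i j assume "i < dim_row (S * S)" "j < dim_col (S * S)"
    then have ij: "i < n" "j < n" using S by auto
    show "(mat_adjoint Y * Y) $$ (i, j) = (S * S) $$ (i, j)"
      unfolding key[OF ij] diagonal_mat_sq_index[OF S dS ij]
      using le[OF ij(1)] ij by (auto simp: S_def power2_eq_square simp flip: of_real_mult)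
  qed (use S Y in auto)
  ultimately show thesis using that S by blast
qed

text \<open>The singular value decomposition of \<open>K11\<close> gives \<open>U1\<close>,
\<open>C\<close> and \<open>V1\<close>. The first block column then forces \<open>K21
V1\<^sup>*\<close> to have Gram matrix \<open>I - C\<^sup>2\<close>, and its diagonal polar
decomposition gives \<open>U2\<close> and \<open>S\<close>. For the second block column put \<open>L
= U1\<^sup>* K12\<close> and \<open>N = U2\<^sup>* K22\<close>. Orthogonality of the two block
columns says \<open>C L = S N\<close>, so \<open>V2 = S L + C N\<close> satisfies \<open>S V2 =
L\<close> and \<open>C V2 = N\<close>; dividing by \<open>C\<close> or by \<open>S\<close>, which
may both be singular, is thereby avoided.\<close>

theorem cs_decomposition:
  fixes K11 K12 K21 K22 :: "complex mat"
  assumes K: "K11 \<in> carrier_mat n n" "K12 \<in> carrier_mat n n" "K21 \<in> carrier_mat n n" "K22 \<in> carrier_mat n n"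
    and uni: "unitary_mat (four_block_mat K11 K12 K21 K22)"
  obtains U1 U2 V1 V2 C S where
    "U1 \<in> carrier_mat n n" "U2 \<in> carrier_mat n n" "V1 \<in> carrier_mat n n" "V2 \<in> carrier_mat n n"
    "unitary_mat U1" "unitary_mat U2" "unitary_mat V1" "unitary_mat V2"
    "C \<in> carrier_mat n n" "nonneg_diagonal C" "S \<in> carrier_mat n n" "nonneg_diagonal S"
    "C * C + S * S = 1\<^sub>m n"
    "K11 = U1 * C * V1" "K12 = U1 * S * V2" "K21 = - (U2 * S * V1)" "K22 = U2 * C * V2"
proof -
  note sq = square_mat_algebra[where n = n]
  have Kc: "four_block_mat K11 K12 K21 K22 \<in> carrier_mat (n + n) (n + n)" using K by simp
  have "four_block_mat (mat_adjoint K11 * K11 + mat_adjoint K21 * K21) (mat_adjoint K11 * K12 + mat_adjoint K21 * K22)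
      (mat_adjoint K12 * K11 + mat_adjoint K22 * K21) (mat_adjoint K12 * K12 + mat_adjoint K22 * K22)
    = four_block_mat (1\<^sub>m n) (0\<^sub>m n n) (0\<^sub>m n n) (1\<^sub>m n)"
    using unitary_matD(1)[OF uni Kc] K
    by (simp add: mat_adjoint_four_block[of _ n n _ n _ n] mult_four_block_mat[of _ n n _ n _ n _ _ n _ n])
  then have "mat_adjoint K11 * K11 + mat_adjoint K21 * K21 = 1\<^sub>m n \<and>
      mat_adjoint K11 * K12 + mat_adjoint K21 * K22 = 0\<^sub>m n n \<and>
      mat_adjoint K12 * K11 + mat_adjoint K22 * K21 = 0\<^sub>m n n \<and>
      mat_adjoint K12 * K12 + mat_adjoint K22 * K22 = 1\<^sub>m n"
    by (rule four_block_mat_inject[where ?n1.0 = n and ?n2.0 = n and ?m1.0 = n and ?m2.0 = n])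
      (use K in \<open>auto simp: sq\<close>)
  then have K1: "mat_adjoint K11 * K11 + mat_adjoint K21 * K21 = 1\<^sub>m n"
    and K2: "mat_adjoint K11 * K12 + mat_adjoint K21 * K22 = 0\<^sub>m n n"
    and K3: "mat_adjoint K12 * K12 + mat_adjoint K22 * K22 = 1\<^sub>m n" by blast+
  obtain U1 C V1 where svd: "U1 \<in> carrier_mat n n" "C \<in> carrier_mat n n" "V1 \<in> carrier_mat n n"
    "unitary_mat U1" "nonneg_diagonal C" "unitary_mat V1" "K11 = U1 * C * V1"
    using singular_value_decomposition[OF K(1)] by blast
  note uU1 = unitary_matD[OF svd(4,1)] and uV1 = unitary_matD[OF svd(6,3)]
  have Ca: "mat_adjoint C = C" using nonneg_diagonal_adjoint[OF svd(2,5)] .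
  \<comment> \<open>The minus sign in front of \<open>S\<close> is put into the block first, so that
    \<open>U2\<close> comes out of a plain polar decomposition.\<close>
  define M where "M = - K21"
  have M: "M \<in> carrier_mat n n" using K by (simp add: M_def)
  have K21: "K21 = - M" using K by (auto simp: M_def intro!: eq_matI)
  have MM: "mat_adjoint K21 * K21 = mat_adjoint M * M"
    using M unfolding K21 by (intro eq_matI) (auto simp: scalar_prod_def sum_negf)
  have K11sq: "mat_adjoint K11 * K11 = mat_adjoint V1 * (C * (C * V1))"
  proof -
    have "mat_adjoint K11 * K11 = mat_adjoint V1 * (C * ((mat_adjoint U1 * U1) * (C * V1)))"
      unfolding svd(7) using svd(1-3) by (simp add: sq Ca)
    then show ?thesis using svd(2,3) by (simp add: uU1 sq)
  qed
  define Y where "Y = M * mat_adjoint V1"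
  have Y: "Y \<in> carrier_mat n n" using M svd(3) by (simp add: Y_def sq)
  have "C * C + mat_adjoint Y * Y = 1\<^sub>m n"
  proof -
    have "V1 * (mat_adjoint K11 * K11 + mat_adjoint M * M) * mat_adjoint V1
      = (V1 * mat_adjoint V1) * C * (C * (V1 * mat_adjoint V1)) + mat_adjoint Y * Y"
      unfolding K11sq using svd(2,3) M by (simp add: sq Y_def)
    then show ?thesis using K1 svd(2,3) by (simp add: MM uV1)
  qed
  then obtain S where S: "S \<in> carrier_mat n n" "nonneg_diagonal S" "mat_adjoint Y * Y = S * S"
    using complementary_diagonal_exists[OF svd(2,5) Y] by blast
  with \<open>C * C + mat_adjoint Y * Y = 1\<^sub>m n\<close> have CS: "C * C + S * S = 1\<^sub>m n" by simp
  have Sa: "mat_adjoint S = S" using nonneg_diagonal_adjoint[OF S(1,2)] .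
  obtain U2 where U2: "U2 \<in> carrier_mat n n" "unitary_mat U2" "Y = U2 * S"
    using polar_diagonal[OF Y S] by blast
  note uU2 = unitary_matD[OF U2(2,1)]
  have MU: "M = U2 * S * V1"
  proof -
    have "M * (mat_adjoint V1 * V1) = U2 * S * V1"
      using U2(3) M svd(3) by (simp add: Y_def flip: assoc_mult_mat[of _ n n _ n _ n])
    then show ?thesis using M by (simp add: uV1)
  qed
  define L where "L = mat_adjoint U1 * K12"
  define N where "N = mat_adjoint U2 * K22"
  have L: "L \<in> carrier_mat n n" using svd K by (simp add: L_def sq)
  have N: "N \<in> carrier_mat n n" using U2 K by (simp add: N_def sq)
  have K12: "K12 = U1 * L"
  proof -
    have "U1 * L = (U1 * mat_adjoint U1) * K12" using svd(1) K by (simp add: L_def sq)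
    then show ?thesis using K by (simp add: uU1)
  qed
  have K22: "K22 = U2 * N"
  proof -
    have "U2 * N = (U2 * mat_adjoint U2) * K22" using U2(1) K by (simp add: N_def sq)
    then show ?thesis using K by (simp add: uU2)
  qed
  have CL: "C * L = S * N"
  proof -
    have a: "mat_adjoint K11 * K12 = mat_adjoint V1 * (C * L)"
      unfolding svd(7) L_def using svd(1-3) K by (simp add: sq Ca)
    have b: "mat_adjoint M * K22 = mat_adjoint V1 * (S * N)"
      unfolding MU N_def using svd(3) S U2(1) K by (simp add: sq Sa)
    have "mat_adjoint K11 * K12 = mat_adjoint M * K22"
    proof (rule eq_matI)
      fix i j assume "i < dim_row (mat_adjoint M * K22)" "j < dim_col (mat_adjoint M * K22)"
      then have ij: "i < n" "j < n" using M K by auto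
      have "(mat_adjoint K21 * K22) $$ (i, j) = - ((mat_adjoint M * K22) $$ (i, j))"
        using M K ij unfolding K21 by (auto simp: scalar_prod_def sum_negf)
      moreover have "(mat_adjoint K11 * K12 + mat_adjoint K21 * K22) $$ (i, j) =
        (mat_adjoint K11 * K12) $$ (i, j) + (mat_adjoint K21 * K22) $$ (i, j)"
        using K ij by (intro index_add_mat) auto
      ultimately show "(mat_adjoint K11 * K12) $$ (i, j) = (mat_adjoint M * K22) $$ (i, j)"
        unfolding K2 using ij by simp
    qed (use K M in auto)
    then have "V1 * (mat_adjoint V1 * (C * L)) = V1 * (mat_adjoint V1 * (S * N))" using a b by simp
    then have "(V1 * mat_adjoint V1) * (C * L) = (V1 * mat_adjoint V1) * (S * N)"
      using svd(2,3) S L N by (simp add: sq)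
    moreover have "C * L \<in> carrier_mat n n" "S * N \<in> carrier_mat n n" using svd S L N by (auto simp: sq)
    ultimately show ?thesis unfolding uV1 by (metis left_mult_one_mat)
  qed
  have SC: "S * C = C * S"
    using diagonal_mat_commute[OF S(1) _ svd(2)] S svd by (simp add: nonneg_diagonal_def)
  have CSX: "C * (C * X) + S * (S * X) = X" if X: "X \<in> carrier_mat n n" for X
  proof -
    have "C * (C * X) + S * (S * X) = (C * C + S * S) * X" using X svd(2) S by (simp add: sq)
    then show ?thesis using X by (simp add: CS)
  qed
  have SCN: "S * (C * N) = C * (C * L)"
  proof -
    have "S * (C * N) = (S * C) * N" using svd(2) S N by (simp add: sq)
    also have "\<dots> = C * (S * N)" unfolding SC using svd(2) S N by (simp add: sq)
    finally show ?thesis by (simp add: CL)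
  qed
  have CSL: "C * (S * L) = S * (S * N)"
  proof -
    have "C * (S * L) = (C * S) * L" using svd(2) S L by (simp add: sq)
    also have "\<dots> = S * (C * L)" unfolding SC[symmetric] using svd(2) S L by (simp add: sq)
    finally show ?thesis by (simp add: CL)
  qed
  define V2 where "V2 = S * L + C * N"
  have V2: "V2 \<in> carrier_mat n n" using svd S L N by (simp add: V2_def sq)
  have SV2: "S * V2 = L"
  proof -
    have "S * V2 = S * (S * L) + C * (C * L)" using svd(2) S L N by (simp add: V2_def sq SCN)
    also have "\<dots> = C * (C * L) + S * (S * L)"
      using svd(2) S L by (intro comm_add_mat[of _ n n]) (auto simp: sq)
    finally show ?thesis by (simp add: CSX L)
  qed
  have CV2: "C * V2 = N"
  proof -
    have "C * V2 = S * (S * N) + C * (C * N)" using svd(2) S L N by (simp add: V2_def sq CSL)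
    also have "\<dots> = C * (C * N) + S * (S * N)"
      using svd(2) S N by (intro comm_add_mat[of _ n n]) (auto simp: sq)
    finally show ?thesis by (simp add: CSX N)
  qed
  have "unitary_mat V2"
  proof (rule unitary_matI[OF V2])
    have "mat_adjoint V2 * V2 = mat_adjoint L * (S * V2) + mat_adjoint N * (C * V2)"
    proof -
      have "mat_adjoint V2 = mat_adjoint L * S + mat_adjoint N * C"
        using svd(2) S L N by (simp add: V2_def mat_adjoint_add[of _ n n] sq Sa Ca)
      then show ?thesis using svd(2) S L N V2 by (simp add: sq)
    qed
    also have "\<dots> = mat_adjoint K12 * K12 + mat_adjoint K22 * K22"
    proof -
      have "mat_adjoint K12 * K12 = mat_adjoint L * ((mat_adjoint U1 * U1) * L)"
        unfolding K12 using svd(1) L by (simp add: sq)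
      moreover have "mat_adjoint K22 * K22 = mat_adjoint N * ((mat_adjoint U2 * U2) * N)"
        unfolding K22 using U2(1) N by (simp add: sq)
      ultimately show ?thesis using L N by (simp add: uU1 uU2 SV2 CV2)
    qed
    finally show "mat_adjoint V2 * V2 = 1\<^sub>m n" by (simp add: K3)
  qed
  moreover have "K12 = U1 * S * V2" using K12 SV2 svd(1) S V2 by (simp add: sq)
  moreover have "K22 = U2 * C * V2" using K22 CV2 svd(2) U2 V2 by (simp add: sq)
  moreover have "K21 = - (U2 * S * V1)" using K21 MU by simp
  ultimately show thesis
    using that[OF svd(1) U2(1) svd(3) V2 svd(4) U2(2) svd(6) _ svd(2,5) S(1,2) CS svd(7)] by blast
qed

section \<open>Rank\<close>

context vec_space
begin

lemma rank_mult_invertible_right: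
  assumes A: "A \<in> carrier_mat n m" and Y: "Y \<in> carrier_mat m m"
    and Y': "Y' \<in> carrier_mat m m" and inv: "Y * Y' = 1\<^sub>m m"
  shows "rank (A * Y) = rank A"
proof -
  have AY: "A * Y \<in> carrier_mat n m" using A Y by simp
  have "col_space (A * Y) = col_space A"
  proof
    show "col_space (A * Y) \<subseteq> col_space A"
      unfolding col_space_eq[OF A] col_space_eq[OF AY] using A Y
      by (auto simp: assoc_mult_mat_vec[of _ n m _ m] intro: mult_mat_vec_carrier)
    show "col_space A \<subseteq> col_space (A * Y)"
    proof
      fix y assume "y \<in> col_space A"
      then obtain x where x: "x \<in> carrier_vec m" "y = A *\<^sub>v x" "y \<in> carrier_vec n"
        unfolding col_space_eq[OF A] using A by auto
      have "(A * Y) *\<^sub>v (Y' *\<^sub>v x) = A *\<^sub>v ((Y * Y') *\<^sub>v x)"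
        using A Y Y' x by (simp only: assoc_mult_mat_vec[of _ n m _ m] assoc_mult_mat_vec[of _ m m _ m] mult_mat_vec_carrier)
      then have "(A * Y) *\<^sub>v (Y' *\<^sub>v x) = y" using x inv by simp
      then show "y \<in> col_space (A * Y)"
        unfolding col_space_eq[OF AY] using A Y Y' x by (auto intro: mult_mat_vec_carrier)
    qed
  qed
  then show ?thesis by (simp add: rank_def col_space_def)
qed

text \<open>Scaling the nonzero diagonal entries to 1 is an invertible column operation, so
\<open>D\<close> may be taken to be a 0/1 matrix. The columns of \<open>X D\<close> are then zero or
distinct members of the basis formed by the columns of \<open>X\<close>.\<close>

lemma rank_diagonal_between_invertible:
  assumes X: "X \<in> carrier_mat n n" and X': "X' \<in> carrier_mat n n" "X * X' = 1\<^sub>m n"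
    and D: "D \<in> carrier_mat n n" "diagonal_mat D"
    and Y: "Y \<in> carrier_mat n n" and Y': "Y' \<in> carrier_mat n n" "Y * Y' = 1\<^sub>m n"
  shows "rank (X * D * Y) = card {i. i < n \<and> D $$ (i, i) \<noteq> 0}"
proof -
  let ?d = "\<lambda>i. D $$ (i, i)"
  define I where "I = {i. i < n \<and> ?d i \<noteq> 0}"
  \<comment> \<open>\<open>D\<close> splits into the 0/1 matrix \<open>P\<close> and the invertible
    \<open>E\<close>, which carries a 1 wherever \<open>D\<close> vanishes.\<close>
  define E where "E = mat n n (\<lambda>(i, j). if i = j then (if ?d i = 0 then 1 else ?d i) else 0)"
  define E' where "E' = mat n n (\<lambda>(i, j). if i = j then (if ?d i = 0 then 1 else 1 / ?d i) else 0)"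
  define P where "P = mat n n (\<lambda>(i, j). if i = j \<and> ?d i \<noteq> 0 then 1 else 0 :: 'a)"
  have E: "E \<in> carrier_mat n n" "diagonal_mat E" and E': "E' \<in> carrier_mat n n"
    and P: "P \<in> carrier_mat n n" "diagonal_mat P"
    by (auto simp: E_def E'_def P_def diagonal_mat_def)
  have EE': "E * E' = 1\<^sub>m n"
  proof (rule eq_matI)
    fix i j assume "i < dim_row (1\<^sub>m n :: 'a mat)" "j < dim_col (1\<^sub>m n :: 'a mat)"
    then have "i < n" "j < n" by auto
    then show "(E * E') $$ (i, j) = 1\<^sub>m n $$ (i, j)"
      unfolding diagonal_mat_mult_index[OF E E' \<open>i < n\<close> \<open>j < n\<close>] by (auto simp: E_def E'_def)
  qed (use E E' in auto)
  have PE: "D = P * E"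
  proof (rule eq_matI)
    fix i j assume "i < dim_row (P * E)" "j < dim_col (P * E)"
    then have "i < n" "j < n" using P E by auto
    then show "D $$ (i, j) = (P * E) $$ (i, j)"
      unfolding diagonal_mat_mult_index[OF P E(1) \<open>i < n\<close> \<open>j < n\<close>]
      using D by (auto simp: E_def P_def diagonal_mat_def)
  qed (use D P E in auto)
  have XP: "X * P \<in> carrier_mat n n" using X P by simp
  have "X * D * Y = ((X * P) * E) * Y" using X P E Y by (simp add: PE assoc_mult_mat[of _ n n _ n _ n])
  then have r: "rank (X * D * Y) = rank (X * P)"
    using rank_mult_invertible_right[OF XP E(1) E' EE']
      rank_mult_invertible_right[OF mult_carrier_mat[OF XP E(1)] Y Y'] by simp
  have colXP: "col (X * P) j = (if j \<in> I then col X j else 0\<^sub>v n)" if "j < n" for j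
  proof (rule eq_vecI)
    fix i assume "i < dim_vec (if j \<in> I then col X j else 0\<^sub>v n)"
    then have i: "i < n" using X by (auto split: if_splits)
    have "col (X * P) j $ i = (X * P) $$ (i, j)" using i that X P by simp
    also have "\<dots> = X $$ (i, j) * P $$ (j, j)" by (rule mult_diagonal_mat_index[OF P X i that])
    finally show "col (X * P) j $ i = (if j \<in> I then col X j else 0\<^sub>v n) $ i"
      using i that X by (auto simp: P_def I_def)
  qed (use X P that in auto)
  have "det X * det X' = 1" using det_mult[OF X X'(1)] X'(2) by simp
  then have detX: "det X \<noteq> 0" by auto
  have dist: "distinct (cols X)"
    using non_distinct_low_rank[OF X] low_rank_det_zero[OF X detX] by auto
  have li: "lin_indpt (set (cols X))"
    using full_rank_lin_indpt[OF X low_rank_det_zero[OF X detX] dist] .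
  define T where "T = col X ` I"
  have In: "I \<subseteq> {..<n}" by (auto simp: I_def)
  have TX: "T \<subseteq> set (cols X)" using X by (auto simp: T_def I_def cols_def)
  have cX: "set (cols X) \<subseteq> carrier_vec n" using X cols_dim by blast
  have liT: "lin_indpt T" using li TX subset_li_is_li by blast
  have TXP: "T \<subseteq> set (cols (X * P))"
  proof
    fix x assume "x \<in> T"
    then obtain j where j: "j \<in> I" "x = col X j" by (auto simp: T_def)
    then have "x = col (X * P) j" "j < dim_col (X * P)" using colXP[of j] P by (auto simp: I_def)
    then show "x \<in> set (cols (X * P))" by (auto simp: cols_def)
  qed
  have sub: "set (cols (X * P)) \<subseteq> insert (0\<^sub>v n) T"
    using P colXP by (auto simp: cols_def T_def)
  have "maximal T (\<lambda>T. T \<subseteq> set (cols (X * P)) \<and> lin_indpt T)"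
    unfolding maximal_def
  proof (intro conjI allI impI)
    fix B assume B: "T \<subseteq> B \<and> B \<subseteq> set (cols (X * P)) \<and> lin_indpt B"
    have "(UNIV :: 'a set) \<noteq> {0}" using zero_neq_one by (metis UNIV_I singletonD)
    with B have "0\<^sub>v n \<notin> B" using zero_nin_lin_indpt[of B] cols_dim[of "X * P"] X by auto
    with B show "B = T" using sub by blast
  qed (use TXP liT in auto)
  then have "rank (X * P) = card T" by (rule rank_card_indpt[OF XP])
  also have "card T = card I"
  proof -
    have "inj_on (col X) I"
    proof (rule inj_onI)
      fix i j assume "i \<in> I" "j \<in> I" "col X i = col X j"
      then show "i = j"
        using dist X In nth_eq_iff_index_eq[OF dist, of i j] by (auto simp: I_def)
    qed
    then show ?thesis unfolding T_def by (rule card_image)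
  qed
  finally show ?thesis using r by (simp add: I_def)
qed

text \<open>With full row rank the columns span the whole space, so a vector orthogonal to all of
them is orthogonal to every unit vector.\<close>

lemma full_row_rank_orthogonal_imp_zero:
  assumes A: "A \<in> carrier_mat n m" and r: "rank A = n"
    and v: "v \<in> carrier_vec n" and orth: "\<And>j. j < m \<Longrightarrow> v \<bullet> col A j = 0"
  shows "v = 0\<^sub>v n"
proof -
  obtain S where S: "maximal S (\<lambda>T. T \<subseteq> set (cols A) \<and> lin_indpt T)"
    using maximal_exists[of "\<lambda>T. T \<subseteq> set (cols A) \<and> lin_indpt T" "card (set (cols A))" "{}"]
    by (meson List.finite_set card_mono empty_iff empty_subsetI finite_lin_indpt2 rev_finite_subset)
  then have S': "S \<subseteq> set (cols A)" "lin_indpt S" by (auto simp: maximal_def)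
  have cS: "S \<subseteq> carrier_vec n" using S'(1) A cols_dim by blast
  have "card S = n" using rank_card_indpt[OF A S] r by simp
  then have "basis S"
    using dim_li_is_basis[OF fin_dim finite_subset[OF S'(1)] _ S'(2)] cS by (simp add: dim_is_n)
  then have sp: "span S = carrier_vec n" by (simp add: basis_def)
  have "v \<in> orthogonal_complement S"
    using S' v orth A by (auto simp: orthogonal_complement_def cols_def)
  then have "v \<in> orthogonal_complement (carrier_vec n)"
    using in_orthogonal_complement_span[OF cS] sp by simp
  then have "v \<bullet> unit_vec n i = 0" for i by (auto simp: orthogonal_complement_def)
  then have "v $ i = 0" if "i < n" for i using that v by (metis scalar_prod_right_unit)
  then show ?thesis using v by (intro eq_vecI) auto
qed

end

section \<open>Matrices placed side by side\<close>

lemma append_cols_carrier [simp]: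
  "P \<in> carrier_mat n k \<Longrightarrow> Q \<in> carrier_mat n l \<Longrightarrow> P @\<^sub>c Q \<in> carrier_mat n (k + l)"
  by (auto simp: append_cols_def)

lemma append_cols_mult_four_block:
  fixes P :: "'a :: comm_ring_1 mat"
  assumes "P \<in> carrier_mat n k" "Q \<in> carrier_mat n l"
    "A \<in> carrier_mat k k'" "B \<in> carrier_mat k l'" "C \<in> carrier_mat l k'" "D \<in> carrier_mat l l'"
  shows "(P @\<^sub>c Q) * four_block_mat A B C D = (P * A + Q * C) @\<^sub>c (P * B + Q * D)"
  unfolding append_cols_def using assms
  by (subst mult_four_block_mat[of _ n k _ l _ 0 _ _ k' _ l']) (auto intro!: cong_four_block_mat)

lemma append_cols_mult_diag_block:
  fixes P :: "'a :: comm_ring_1 mat"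
  assumes "P \<in> carrier_mat n k" "Q \<in> carrier_mat n l" "A \<in> carrier_mat k k'" "D \<in> carrier_mat l l'"
  shows "(P @\<^sub>c Q) * four_block_mat A (0\<^sub>m k l') (0\<^sub>m l k') D = (P * A) @\<^sub>c (Q * D)"
  using assms by (subst append_cols_mult_four_block[of _ n k _ l _ k' _ l']) auto

lemma col_append_cols:
  assumes "P \<in> carrier_mat n k" "Q \<in> carrier_mat n l" "j < k + l"
  shows "col (P @\<^sub>c Q) j = (if j < k then col P j else col Q (j - k))"
  using assms by (intro eq_vecI) (auto simp: append_cols_def)

lemma mult_append_cols:
  fixes P :: "'a :: comm_ring_1 mat"
  assumes U: "U \<in> carrier_mat m n" and P: "P \<in> carrier_mat n k" and Q: "Q \<in> carrier_mat n l"
  shows "U * (P @\<^sub>c Q) = (U * P) @\<^sub>c (U * Q)"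
proof (rule eq_matI)
  fix i j assume "i < dim_row ((U * P) @\<^sub>c (U * Q))" "j < dim_col ((U * P) @\<^sub>c (U * Q))"
  then have "i < m" "j < k + l" using assms by (auto simp: append_cols_def)
  then show "(U * (P @\<^sub>c Q)) $$ (i, j) = ((U * P) @\<^sub>c (U * Q)) $$ (i, j)"
    using assms carrier_matD[OF append_cols_carrier[OF P Q]]
    by (simp add: col_append_cols[OF P Q]) (auto simp: append_cols_def)
qed (use assms in \<open>auto simp: append_cols_def\<close>)

lemma mat_adjoint_append_cols:
  fixes P :: "complex mat"
  assumes "P \<in> carrier_mat n k" "Q \<in> carrier_mat n l"
  shows "mat_adjoint (P @\<^sub>c Q) = mat_adjoint P @\<^sub>r mat_adjoint Q"
  using assms by (intro eq_matI) (auto simp: append_cols_def append_rows_def)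

lemma append_cols_mult_append_rows:
  fixes P :: "'a :: comm_ring_1 mat"
  assumes "P \<in> carrier_mat n k" "Q \<in> carrier_mat n l" "R \<in> carrier_mat k m" "T \<in> carrier_mat l m"
  shows "(P @\<^sub>c Q) * (R @\<^sub>r T) = P * R + Q * T"
proof -
  have "(P @\<^sub>c Q) * (R @\<^sub>r T) = (P * R + Q * T) @\<^sub>c (P * 0\<^sub>m k 0 + Q * 0\<^sub>m l 0)"
    using assms unfolding append_rows_def
    by (subst append_cols_mult_four_block[of _ n k _ l _ m _ 0]) auto
  also have "\<dots> = P * R + Q * T"
    using assms by (intro eq_matI) (auto simp: append_cols_def)
  finally show ?thesis .
qed

lemma append_cols_mult_adjoint:
  fixes P :: "complex mat"
  assumes "P \<in> carrier_mat n k" "Q \<in> carrier_mat n l" "R \<in> carrier_mat m k" "T \<in> carrier_mat m l"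
  shows "(P @\<^sub>c Q) * mat_adjoint (R @\<^sub>c T) = P * mat_adjoint R + Q * mat_adjoint T"
  using assms by (simp add: mat_adjoint_append_cols append_cols_mult_append_rows[of _ n k _ l _ m])

lemma adjoint_append_cols_mult_vec_eq_0:
  fixes P :: "complex mat"
  assumes "P \<in> carrier_mat n k" "Q \<in> carrier_mat n l" "w \<in> carrier_vec n"
  shows "mat_adjoint (P @\<^sub>c Q) *\<^sub>v w = 0\<^sub>v (k + l) \<longleftrightarrow>
    mat_adjoint P *\<^sub>v w = 0\<^sub>v k \<and> mat_adjoint Q *\<^sub>v w = 0\<^sub>v l"
proof -
  have "mat_adjoint (P @\<^sub>c Q) *\<^sub>v w = (mat_adjoint P *\<^sub>v w) @\<^sub>v (mat_adjoint Q *\<^sub>v w)"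
    using assms by (simp add: mat_adjoint_append_cols mat_mult_append[of _ k n _ l])
  moreover have "0\<^sub>v (k + l) = 0\<^sub>v k @\<^sub>v (0\<^sub>v l :: complex vec)" by (intro eq_vecI) auto
  moreover have "mat_adjoint P *\<^sub>v w \<in> carrier_vec k"
    using assms by (intro mult_mat_vec_carrier[of _ k n]) auto
  ultimately show ?thesis using append_vec_eq[of _ k "0\<^sub>v k"] by simp
qed

lemma append_cols_inject:
  assumes "P @\<^sub>c Q = P' @\<^sub>c Q'"
    "P \<in> carrier_mat n k" "Q \<in> carrier_mat n l" "P' \<in> carrier_mat n k" "Q' \<in> carrier_mat n l"
  shows "P = P'" "Q = Q'"
  using four_block_mat_inject[OF assms(1)[unfolded append_cols_def], of n k l 0] assms(2-) by auto

lemma append_cols_split: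
  assumes "A \<in> carrier_mat n (k + l)"
  obtains P Q where "P \<in> carrier_mat n k" "Q \<in> carrier_mat n l" "A = P @\<^sub>c Q"
proof -
  let ?P = "mat n k (\<lambda>(i, j). A $$ (i, j))" and ?Q = "mat n l (\<lambda>(i, j). A $$ (i, j + k))"
  have "A = ?P @\<^sub>c ?Q" using assms by (intro eq_matI) (auto simp: append_cols_def)
  then show thesis using that[of ?P ?Q] by auto
qed

section \<open>Normal form of a pair of equal Gram matrices\<close>

lemma full_row_rank_adjoint_kernel:
  fixes M :: "complex mat"
  assumes M: "M \<in> carrier_mat n m" and r: "vec_space.rank n M = n"
    and w: "w \<in> carrier_vec n" and ker: "mat_adjoint M *\<^sub>v w = 0\<^sub>v m"
  shows "w = 0\<^sub>v n"
proof -
  interpret vec_space "TYPE(complex)" n .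
  have "conjugate w \<bullet> col M j = 0" if "j < m" for j
  proof -
    have "(mat_adjoint M *\<^sub>v w) $ j = conjugate (conjugate w \<bullet> col M j)"
      using M w that by (auto simp: scalar_prod_def mult.commute intro!: sum.cong)
    then show ?thesis using ker that by simp
  qed
  then have "conjugate w = 0\<^sub>v n"
    using full_row_rank_orthogonal_imp_zero[OF M r, of "conjugate w"] w by simp
  then show ?thesis using w by simp
qed

text \<open>The Gram identity says that \<open>G = (P:T)\<close> and \<open>H = (Q:R)\<close>
satisfy \<open>G G\<^sup>* = H H\<^sup>*\<close>, hence \<open>G\<^sup>*\<close> and
\<open>H\<^sup>*\<close> have the same kernel. That kernel annihilates all four blocks, so it is
trivial and \<open>H\<close> is invertible; then \<open>K = H\<^sup>-\<^sup>1 G\<close> is unitary.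
Its cosine-sine decomposition, multiplied from the left by \<open>H\<close>, expresses
\<open>P\<close> and \<open>T\<close> through \<open>Q\<close> and \<open>R\<close>, and \<open>U =
H diag(U1, U2)\<close> absorbs the left factors.\<close>

theorem cs_normal_form:
  fixes P Q R T :: "complex mat"
  assumes PQRT: "P \<in> carrier_mat (n + n) n" "Q \<in> carrier_mat (n + n) n"
      "R \<in> carrier_mat (n + n) n" "T \<in> carrier_mat (n + n) n"
    and gram: "P * mat_adjoint P + T * mat_adjoint T = Q * mat_adjoint Q + R * mat_adjoint R"
    and ker: "\<And>w. w \<in> carrier_vec (n + n) \<Longrightarrow> mat_adjoint P *\<^sub>v w = 0\<^sub>v n \<Longrightarrow>
      mat_adjoint Q *\<^sub>v w = 0\<^sub>v n \<Longrightarrow> mat_adjoint R *\<^sub>v w = 0\<^sub>v n \<Longrightarrow>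
      mat_adjoint T *\<^sub>v w = 0\<^sub>v n \<Longrightarrow> w = 0\<^sub>v (n + n)"
  obtains U U' U1 U2 V1 V2 C S where
    "U \<in> carrier_mat (n + n) (n + n)" "U' \<in> carrier_mat (n + n) (n + n)" "U * U' = 1\<^sub>m (n + n)"
    "U1 \<in> carrier_mat n n" "U2 \<in> carrier_mat n n" "V1 \<in> carrier_mat n n" "V2 \<in> carrier_mat n n"
    "unitary_mat U1" "unitary_mat U2" "unitary_mat V1" "unitary_mat V2"
    "C \<in> carrier_mat n n" "nonneg_diagonal C" "S \<in> carrier_mat n n" "nonneg_diagonal S"
    "C * C + S * S = 1\<^sub>m n"
    "P @\<^sub>c Q = U * four_block_mat C (1\<^sub>m n) (- S) (0\<^sub>m n n) *
      four_block_mat V1 (0\<^sub>m n n) (0\<^sub>m n n) (mat_adjoint U1)"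
    "R @\<^sub>c T = U * four_block_mat (0\<^sub>m n n) S (1\<^sub>m n) C *
      four_block_mat (mat_adjoint U2) (0\<^sub>m n n) (0\<^sub>m n n) V2"
proof -
  let ?N = "n + n"
  note sq = square_mat_algebra[where n = ?N]
  define G where "G = P @\<^sub>c T"
  define H where "H = Q @\<^sub>c R"
  have G: "G \<in> carrier_mat ?N ?N" and H: "H \<in> carrier_mat ?N ?N"
    using PQRT by (auto simp: G_def H_def)
  have GH: "G * mat_adjoint G = H * mat_adjoint H"
    using PQRT gram by (simp add: G_def H_def append_cols_mult_adjoint[of _ ?N n _ n _ ?N])
  have "w = 0\<^sub>v ?N" if w: "w \<in> carrier_vec ?N" and Hw: "mat_adjoint H *\<^sub>v w = 0\<^sub>v ?N" for w
  proof -
    have Ga: "mat_adjoint G \<in> carrier_mat ?N ?N" and Ha: "mat_adjoint H \<in> carrier_mat ?N ?N"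
      using G H by auto
    have Gw: "mat_adjoint G *\<^sub>v w \<in> carrier_vec ?N" using Ga w by (intro mult_mat_vec_carrier) auto
    have "G *\<^sub>v (mat_adjoint G *\<^sub>v w) = H *\<^sub>v (mat_adjoint H *\<^sub>v w)"
      using assoc_mult_mat_vec[OF G Ga w] assoc_mult_mat_vec[OF H Ha w] GH by simp
    also have "\<dots> = 0\<^sub>v ?N" unfolding Hw using H by (intro eq_vecI) auto
    \<comment> \<open>\<open>G G\<^sup>* w = 0\<close> already gives \<open>G\<^sup>* w = 0\<close>,
      since the inner product with \<open>w\<close> is the squared norm of \<open>G\<^sup>*
      w\<close>.\<close>
    finally have "(mat_adjoint G *\<^sub>v w) \<bullet>c (mat_adjoint G *\<^sub>v w) = 0"
      using sprod_mat_adjoint[OF Ga w Gw] w by simp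
    then have "mat_adjoint G *\<^sub>v w = 0\<^sub>v ?N" using Gw by simp
    then show ?thesis
      using Hw ker[OF w] PQRT w
      by (simp add: G_def H_def adjoint_append_cols_mult_vec_eq_0[of _ ?N n _ n])
  qed
  then obtain Hi where Hi: "Hi \<in> carrier_mat ?N ?N" "Hi * H = 1\<^sub>m ?N" "H * Hi = 1\<^sub>m ?N"
    using adjoint_kernel_trivial_imp_inverse[OF H] by blast
  define K where "K = Hi * G"
  have K: "K \<in> carrier_mat ?N ?N" using Hi G by (simp add: K_def)
  have HK: "H * K = G"
  proof -
    have "H * K = (H * Hi) * G" using H Hi(1) G by (simp add: K_def sq)
    then show ?thesis unfolding Hi(3) using G by simp
  qed
  have "unitary_mat (mat_adjoint K)"
  proof (rule unitary_matI)
    have "mat_adjoint (mat_adjoint K) * mat_adjoint K = Hi * ((G * mat_adjoint G) * mat_adjoint Hi)"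
      using Hi G by (simp add: K_def sq)
    also have "\<dots> = (Hi * H) * mat_adjoint (Hi * H)"
      unfolding GH using Hi(1) H by (simp add: sq)
    finally show "mat_adjoint (mat_adjoint K) * mat_adjoint K = 1\<^sub>m ?N" by (simp add: Hi)
  qed (use K in auto)
  then have uK: "unitary_mat K" using unitary_mat_adjoint by fastforce
  obtain K11 K12 K21 K22 where sp: "split_block K n n = (K11, K12, K21, K22)"
    by (metis prod_cases4)
  note Kb = split_block[OF sp, of n n] 
  have Kc: "K11 \<in> carrier_mat n n" "K12 \<in> carrier_mat n n" "K21 \<in> carrier_mat n n" "K22 \<in> carrier_mat n n"
    and Keq: "K = four_block_mat K11 K12 K21 K22" using Kb K by auto
  obtain U1 U2 V1 V2 C S where cs:
    "U1 \<in> carrier_mat n n" "U2 \<in> carrier_mat n n" "V1 \<in> carrier_mat n n" "V2 \<in> carrier_mat n n"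
    "unitary_mat U1" "unitary_mat U2" "unitary_mat V1" "unitary_mat V2"
    "C \<in> carrier_mat n n" "nonneg_diagonal C" "S \<in> carrier_mat n n" "nonneg_diagonal S"
    "C * C + S * S = 1\<^sub>m n"
    "K11 = U1 * C * V1" "K12 = U1 * S * V2" "K21 = - (U2 * S * V1)" "K22 = U2 * C * V2"
    using cs_decomposition[OF Kc uK[unfolded Keq]] by blast
  have "P @\<^sub>c T = (Q * K11 + R * K21) @\<^sub>c (Q * K12 + R * K22)"
    using HK PQRT Kc unfolding Keq G_def H_def
    by (simp add: append_cols_mult_four_block[of _ ?N n _ n _ n _ n])
  note PT = append_cols_inject[OF this PQRT(1,4)]
  have Pe: "P = Q * K11 + R * K21" and Te: "T = Q * K12 + R * K22"
    using PT PQRT Kc by (auto simp: mult_carrier_mat[of _ ?N n _ n])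
  let ?X = "four_block_mat U1 (0\<^sub>m n n) (0\<^sub>m n n) U2"
  have X: "?X \<in> carrier_mat ?N ?N" "unitary_mat ?X"
    using cs unitary_mat_diag_block by auto
  define U where "U = H * ?X"
  have U: "U \<in> carrier_mat ?N ?N" using H X(1) unfolding U_def by (rule mult_carrier_mat)
  have Ub: "U = (Q * U1) @\<^sub>c (R * U2)"
    using PQRT cs by (simp add: U_def H_def append_cols_mult_diag_block[of _ ?N n _ n _ n])
  define U' where "U' = mat_adjoint ?X * Hi"
  have Xa: "mat_adjoint ?X \<in> carrier_mat ?N ?N" using X(1) by (rule mat_adjoint_carrier)
  have U': "U' \<in> carrier_mat ?N ?N" unfolding U'_def by (rule mult_carrier_mat[OF Xa Hi(1)])
  have UU': "U * U' = 1\<^sub>m ?N"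
  proof -
    have "U * U' = H * ((?X * mat_adjoint ?X) * Hi)"
      unfolding U_def U'_def
      using assoc_mult_mat[OF H X(1) mult_carrier_mat[OF Xa Hi(1)]] assoc_mult_mat[OF X(1) Xa Hi(1)] by simp
    then show ?thesis using unitary_matD(2)[OF X(2,1)] Hi by simp
  qed
  have c: "Q * U1 \<in> carrier_mat ?N n" "R * U2 \<in> carrier_mat ?N n"
    using PQRT cs by (auto intro: mult_carrier_mat)
  note re = assoc_mult_mat[of _ ?N n _ n _ n] assoc_mult_mat[of _ n n _ n _ n]
    mult_carrier_mat[of _ ?N n _ n] mult_carrier_mat[of _ n n _ n]
    add_mult_distrib_mat[of _ ?N n _ _ n] add_carrier_mat[of _ ?N n]
  have PQ: "P @\<^sub>c Q = U * four_block_mat C (1\<^sub>m n) (- S) (0\<^sub>m n n) *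
      four_block_mat V1 (0\<^sub>m n n) (0\<^sub>m n n) (mat_adjoint U1)"
  proof -
    have "U * four_block_mat C (1\<^sub>m n) (- S) (0\<^sub>m n n) = (Q * U1 * C + R * U2 * - S) @\<^sub>c (Q * U1)"
      using PQRT cs c by (simp add: Ub append_cols_mult_four_block[of _ ?N n _ n _ n _ n])
    moreover have "(Q * U1 * C + R * U2 * - S) * V1 = P"
      using PQRT cs by (simp add: Pe re)
    moreover have "Q * U1 * mat_adjoint U1 = Q"
      using PQRT cs by (simp add: re unitary_matD(2)[of U1 n])
    moreover have "Q * U1 * C + R * U2 * - S \<in> carrier_mat ?N n" 
      using PQRT cs by (auto simp: re)
    ultimately show ?thesis
      using cs c by (simp add: append_cols_mult_diag_block[of _ ?N n _ n _ n])
  qed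
  have RT: "R @\<^sub>c T = U * four_block_mat (0\<^sub>m n n) S (1\<^sub>m n) C *
      four_block_mat (mat_adjoint U2) (0\<^sub>m n n) (0\<^sub>m n n) V2"
  proof -
    have "U * four_block_mat (0\<^sub>m n n) S (1\<^sub>m n) C = (R * U2) @\<^sub>c (Q * U1 * S + R * U2 * C)"
      using PQRT cs c by (simp add: Ub append_cols_mult_four_block[of _ ?N n _ n _ n _ n])
    moreover have "(Q * U1 * S + R * U2 * C) * V2 = T"
      using PQRT cs by (simp add: Te re)
    moreover have "R * U2 * mat_adjoint U2 = R"
      using PQRT cs by (simp add: re unitary_matD(2)[of U2 n])
    moreover have "Q * U1 * S + R * U2 * C \<in> carrier_mat ?N n" 
      using PQRT cs by (auto simp: re)
    ultimately show ?thesis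
      using cs c by (simp add: append_cols_mult_diag_block[of _ ?N n _ n _ n])
  qed
  show thesis using that[OF U U' UU' cs(1-13) PQ RT] .
qed

section \<open>Ranks of the two halves of the normal form\<close>

lemma card_diag_block_nonzero:
  assumes "A \<in> carrier_mat n n" "B \<in> carrier_mat m m"
  shows "card {i. i < n + m \<and> four_block_mat A (0\<^sub>m n m) (0\<^sub>m m n) B $$ (i, i) \<noteq> 0} =
    card {i. i < n \<and> A $$ (i, i) \<noteq> 0} + card {i. i < m \<and> B $$ (i, i) \<noteq> 0}"
proof -
  let ?A = "{i. i < n \<and> A $$ (i, i) \<noteq> 0}" and ?B = "{i. i < m \<and> B $$ (i, i) \<noteq> 0}"
  have "{i. i < n + m \<and> four_block_mat A (0\<^sub>m n m) (0\<^sub>m m n) B $$ (i, i) \<noteq> 0} = ?A \<union> (+) n ` ?B" (is "?L = ?R")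
  proof
    show "?L \<subseteq> ?R"
    proof
      fix i assume "i \<in> ?L"
      then show "i \<in> ?R" using assms by (cases "i < n") (auto intro!: image_eqI[of _ _ "i - n"])
    qed
  qed (use assms in auto)
  also have "card \<dots> = card ?A + card ((+) n ` ?B)" by (rule card_Un_disjoint) auto
  also have "card ((+) n ` ?B) = card ?B" by (rule card_image) simp
  finally show ?thesis .
qed

lemma rank_diagonal:
  fixes S :: "complex mat"
  assumes "S \<in> carrier_mat n n" "diagonal_mat S"
  shows "vec_space.rank n S = card {i. i < n \<and> S $$ (i, i) \<noteq> 0}"
proof -
  interpret vec_space "TYPE(complex)" n .
  show ?thesis using rank_diagonal_between_invertible[of "1\<^sub>m n" "1\<^sub>m n" S "1\<^sub>m n" "1\<^sub>m n"] assms by simp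
qed

lemma rank_diagonal_eq_0:
  fixes S :: "complex mat"
  assumes S: "S \<in> carrier_mat n n" "diagonal_mat S"
  shows "vec_space.rank n S = 0 \<longleftrightarrow> S = 0\<^sub>m n n"
proof -
  have "vec_space.rank n S = 0 \<longleftrightarrow> (\<forall>i < n. S $$ (i, i) = 0)"
    unfolding rank_diagonal[OF S] by (subst card_eq_0_iff) auto
  also have "\<dots> \<longleftrightarrow> S = 0\<^sub>m n n"
  proof
    assume z: "\<forall>i < n. S $$ (i, i) = 0"
    show "S = 0\<^sub>m n n"
    proof (rule eq_matI)
      fix i j assume "i < dim_row (0\<^sub>m n n :: complex mat)" "j < dim_col (0\<^sub>m n n :: complex mat)"
      then show "S $$ (i, j) = 0\<^sub>m n n $$ (i, j)"
        using z S by (cases "i = j") (auto simp: diagonal_mat_def)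
    qed (use S in auto)
  qed auto
  finally show ?thesis .
qed

text \<open>A block column operation with the identity block removes \<open>C\<close>, and a signed
permutation of the block rows leaves \<open>diag(S, I)\<close> and \<open>diag(I, S)\<close>
respectively.\<close>

lemma rank_cs_block:
  fixes C S :: "complex mat"
  assumes U: "U \<in> carrier_mat (n + n) (n + n)" "U' \<in> carrier_mat (n + n) (n + n)" "U * U' = 1\<^sub>m (n + n)"
    and V: "V \<in> carrier_mat (n + n) (n + n)" "V' \<in> carrier_mat (n + n) (n + n)" "V * V' = 1\<^sub>m (n + n)"
    and C: "C \<in> carrier_mat n n" and S: "S \<in> carrier_mat n n" "diagonal_mat S"
  shows "vec_space.rank (n + n) (U * four_block_mat C (1\<^sub>m n) (- S) (0\<^sub>m n n) * V) = n + vec_space.rank n S"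
    and "vec_space.rank (n + n) (U * four_block_mat (0\<^sub>m n n) S (1\<^sub>m n) C * V) = n + vec_space.rank n S"
proof -
  let ?N = "n + n"
  let ?o = "1\<^sub>m n :: complex mat" and ?z = "0\<^sub>m n n :: complex mat"
  have [simp]: "- ?z = ?z" by (rule eq_matI) auto
  have [simp]: "C + - C = ?z" "- C + C = ?z" using C by (auto intro!: eq_matI)
  note fb = mult_four_block_mat[of _ n n _ n _ n _ _ n _ n]
  note rS = rank_diagonal[OF S]
  have "{i. i < n \<and> ?o $$ (i, i) \<noteq> 0} = {..<n}" by auto
  then have card1: "card {i. i < n \<and> ?o $$ (i, i) \<noteq> 0} = n" by simp
  interpret vec_space "TYPE(complex)" ?N .
  have main: "rank (U * (J * D * L) * V) = card {i. i < ?N \<and> D $$ (i, i) \<noteq> 0}"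
    if "J \<in> carrier_mat ?N ?N" "J' \<in> carrier_mat ?N ?N" "J * J' = 1\<^sub>m ?N"
      "D \<in> carrier_mat ?N ?N" "diagonal_mat D"
      "L \<in> carrier_mat ?N ?N" "L' \<in> carrier_mat ?N ?N" "L * L' = 1\<^sub>m ?N" for J J' D L L'
  proof -
    note sq = assoc_mult_mat[of _ ?N ?N _ ?N _ ?N] mult_carrier_mat[of _ ?N ?N _ ?N]
    have "(U * J) * (J' * U') = U * ((J * J') * U')" using U(1,2) that(1,2) by (simp add: sq)
    also have "\<dots> = 1\<^sub>m ?N" unfolding that(3) using U by simp
    finally have 1: "(U * J) * (J' * U') = 1\<^sub>m ?N" .
    have "(L * V) * (V' * L') = L * ((V * V') * L')" using V(1,2) that(6,7) by (simp add: sq)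
    also have "\<dots> = 1\<^sub>m ?N" unfolding V(3) using that by simp
    finally have 2: "(L * V) * (V' * L') = 1\<^sub>m ?N" .
    have "U * (J * D * L) * V = (U * J) * D * (L * V)" using U V that by (simp add: sq)
    then show ?thesis
      using rank_diagonal_between_invertible[OF _ _ 1 that(4,5) _ _ 2] U V that by (simp add: sq)
  qed
  have "four_block_mat ?z ?o (- ?o) ?z * four_block_mat S ?z ?z ?o * four_block_mat ?o ?z C ?o
      = four_block_mat C ?o (- S) ?z"
    using C S by (simp add: fb)
  moreover have "four_block_mat ?z ?o (- ?o) ?z * four_block_mat ?z (- ?o) ?o ?z = 1\<^sub>m ?N"
    by (simp add: fb)
  moreover have "four_block_mat ?o ?z C ?o * four_block_mat ?o ?z (- C) ?o = 1\<^sub>m ?N"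
    using C by (simp add: fb)
  moreover have "diagonal_mat (four_block_mat S ?z ?z ?o)"
    using S by (auto simp: diagonal_mat_def)
  ultimately show "rank (U * four_block_mat C (1\<^sub>m n) (- S) (0\<^sub>m n n) * V) = n + vec_space.rank n S"
    using main[of "four_block_mat ?z ?o (- ?o) ?z" "four_block_mat ?z (- ?o) ?o ?z" "four_block_mat S ?z ?z ?o"
        "four_block_mat ?o ?z C ?o" "four_block_mat ?o ?z (- C) ?o"] S C
      card_diag_block_nonzero[OF S(1) one_carrier_mat[of n]] rS card1 by simp
  have "four_block_mat ?z ?o ?o ?z * four_block_mat ?o ?z ?z S * four_block_mat ?o C ?z ?o
      = four_block_mat ?z S ?o C"
    using C S by (simp add: fb)
  moreover have "four_block_mat ?z ?o ?o ?z * four_block_mat ?z ?o ?o ?z = 1\<^sub>m ?N"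
    by (simp add: fb)
  moreover have "four_block_mat ?o C ?z ?o * four_block_mat ?o (- C) ?z ?o = 1\<^sub>m ?N"
    using C by (simp add: fb)
  moreover have "diagonal_mat (four_block_mat ?o ?z ?z S)"
    using S by (auto simp: diagonal_mat_def)
  ultimately show "rank (U * four_block_mat (0\<^sub>m n n) S (1\<^sub>m n) C * V) = n + vec_space.rank n S"
    using main[of "four_block_mat ?z ?o ?o ?z" "four_block_mat ?z ?o ?o ?z" "four_block_mat ?o ?z ?z S"
        "four_block_mat ?o C ?z ?o" "four_block_mat ?o (- C) ?z ?o"] S C
      card_diag_block_nonzero[OF one_carrier_mat[of n] S(1)] rS card1 by simp
qed

section \<open>The matrices of the boundary value problem\<close>

text \<open>The diagonal block of \<^const>\<open>Z\<close>; it acts on each of the two endpoints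
separately.\<close>

definition Z_block :: "complex mat" where
  "Z_block = complex_of_real (1 / sqrt 2) \<cdot>\<^sub>m four_block_mat (1\<^sub>m 3) (\<i> \<cdot>\<^sub>m C3) (1\<^sub>m 3) (- (\<i> \<cdot>\<^sub>m C3))"

lemma C3_carrier [simp]: "C3 \<in> carrier_mat 3 3"
  by (auto simp: C3_def mat_of_rows_list_def)

lemma one_smult_mat [simp]: "(1 :: complex) \<cdot>\<^sub>m A = A"
  by (rule eq_matI) auto

lemma four_block_carrier_6 [simp]:
  "A \<in> carrier_mat 3 3 \<Longrightarrow> D \<in> carrier_mat 3 3 \<Longrightarrow> four_block_mat A B C D \<in> carrier_mat 6 6"
  using four_block_carrier_mat[of A 3 3 D 3 3] by simp

lemmas mat3_simps = left_mult_one_mat[of _ 3 3] right_mult_one_mat[of _ 3 3]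
  right_mult_zero_mat[of _ 3 3 3] left_mult_zero_mat[of _ 3 3 3]
  left_add_zero_mat[of _ 3 3] right_add_zero_mat[of _ 3 3]

lemma less_3_cases: "i < (3 :: nat) \<Longrightarrow> i = 0 \<or> i = 1 \<or> i = 2"
  by auto

lemma C3_index: "i < 3 \<Longrightarrow> j < 3 \<Longrightarrow> C3 $$ (i, j) = (if i + j = 2 then (if i = 1 then 1 else - 1) else 0)"
  using less_3_cases[of i] less_3_cases[of j] by (auto simp: C3_def mat_of_rows_list_def)

lemma C3_adjoint: "mat_adjoint C3 = C3"
  by (rule eq_matI) (auto simp: C3_index carrier_matD[OF C3_carrier])

lemma C3_sq: "C3 * C3 = 1\<^sub>m 3"
proof (rule eq_matI)
  fix i j assume "i < dim_row (1\<^sub>m 3 :: complex mat)" "j < dim_col (1\<^sub>m 3 :: complex mat)"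
  then have ij: "i < 3" "j < 3" by auto
  then show "(C3 * C3) $$ (i, j) = 1\<^sub>m 3 $$ (i, j)"
    using less_3_cases[of i] less_3_cases[of j]
    by (auto simp: scalar_prod_def C3_index carrier_matD[OF C3_carrier] numeral_3_eq_3)
qed (auto simp: carrier_matD[OF C3_carrier])

text \<open>Rows \<open>r\<close> and \<open>r + 3\<close> carry opposite signs, as 3 is odd; hence
the two off-diagonal blocks are negatives of each other.\<close>

lemma C6_block: "C6 = four_block_mat (0\<^sub>m 3 3) C3 (- C3) (0\<^sub>m 3 3)"
proof (rule eq_matI)
  fix i j assume "i < dim_row (four_block_mat (0\<^sub>m 3 3) C3 (- C3) (0\<^sub>m 3 3))"
    "j < dim_col (four_block_mat (0\<^sub>m 3 3) C3 (- C3) (0\<^sub>m 3 3))"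
  then have ij: "i < 6" "j < 6" by (auto simp: carrier_matD[OF C3_carrier])
  then have "i = 0 \<or> i = 1 \<or> i = 2 \<or> i = 3 \<or> i = 4 \<or> i = 5" "j = 0 \<or> j = 1 \<or> j = 2 \<or> j = 3 \<or> j = 4 \<or> j = 5"
    by auto
  then show "C6 $$ (i, j) = four_block_mat (0\<^sub>m 3 3) C3 (- C3) (0\<^sub>m 3 3) $$ (i, j)"
    by (elim disjE) (simp_all add: C6_def C3_index carrier_matD[OF C3_carrier])
qed (auto simp: C6_def carrier_matD[OF C3_carrier])

lemma Z_block_carrier: "Z_block \<in> carrier_mat 6 6"
  using four_block_carrier_mat[of "1\<^sub>m 3 :: complex mat" 3 3 "- (\<i> \<cdot>\<^sub>m C3)" 3 3] by (simp add: Z_block_def)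

lemma sqrt_half_sq: "complex_of_real (1 / sqrt 2) * complex_of_real (1 / sqrt 2) = 1 / 2"
  by (simp flip: of_real_mult)

lemma Z_block_adjoint: "mat_adjoint Z_block =
  complex_of_real (1 / sqrt 2) \<cdot>\<^sub>m four_block_mat (1\<^sub>m 3) (1\<^sub>m 3) (- \<i> \<cdot>\<^sub>m C3) (\<i> \<cdot>\<^sub>m C3)"
proof -
  have "mat_adjoint (- (\<i> \<cdot>\<^sub>m C3)) = \<i> \<cdot>\<^sub>m C3"
    by (rule eq_matI) (auto simp: mat_adjoint_uminus mat_adjoint_smult C3_adjoint)
  then show ?thesis
    by (simp add: Z_block_def mat_adjoint_smult mat_adjoint_four_block[of _ 3 3 _ 3 _ 3] C3_adjoint)
qed

lemma smult_mult_smult: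
  fixes A :: "complex mat"
  assumes "A \<in> carrier_mat n m" "B \<in> carrier_mat m k"
  shows "(a \<cdot>\<^sub>m A) * (b \<cdot>\<^sub>m B) = (a * b) \<cdot>\<^sub>m (A * B)"
  using assms by (intro eq_matI) (auto simp: mult_ac)

lemma Z_block_unitary: "unitary_mat Z_block"
proof -
  have iC: "(\<i> \<cdot>\<^sub>m C3) * (- \<i> \<cdot>\<^sub>m C3) = 1\<^sub>m 3" 
    by (simp add: smult_mult_smult[of _ 3 3 _ 3] C3_sq)
  have iC': "(- (\<i> \<cdot>\<^sub>m C3)) * (\<i> \<cdot>\<^sub>m C3) = 1\<^sub>m 3"
  proof -
    have "- (\<i> \<cdot>\<^sub>m C3) = - \<i> \<cdot>\<^sub>m C3" by (intro eq_matI) auto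
    then show ?thesis by (simp add: smult_mult_smult[of _ 3 3 _ 3] C3_sq)
  qed
  have a: "(- (\<i> \<cdot>\<^sub>m C3)) * (- \<i> \<cdot>\<^sub>m C3) = - 1\<^sub>m 3" 
  proof -
    have "- (\<i> \<cdot>\<^sub>m C3) = - \<i> \<cdot>\<^sub>m C3" by (intro eq_matI) auto
    then show ?thesis by (simp add: smult_mult_smult[of _ 3 3 _ 3] C3_sq) (auto intro!: eq_matI)
  qed
  have b: "(\<i> \<cdot>\<^sub>m C3) * (\<i> \<cdot>\<^sub>m C3) = - 1\<^sub>m 3" 
    by (simp add: smult_mult_smult[of _ 3 3 _ 3] C3_sq) (auto intro!: eq_matI)
  have "four_block_mat (1\<^sub>m 3) (\<i> \<cdot>\<^sub>m C3) (1\<^sub>m 3) (- (\<i> \<cdot>\<^sub>m C3)) * four_block_mat (1\<^sub>m 3) (1\<^sub>m 3) (- \<i> \<cdot>\<^sub>m C3) (\<i> \<cdot>\<^sub>m C3)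
    = four_block_mat (1\<^sub>m 3 + 1\<^sub>m 3) (1\<^sub>m 3 + - 1\<^sub>m 3) (1\<^sub>m 3 + - 1\<^sub>m 3) (1\<^sub>m 3 + 1\<^sub>m 3)"
    by (subst mult_four_block_mat[of _ 3 3 _ 3 _ 3 _ _ 3 _ 3]) (simp_all only: iC iC' a b, simp_all add: mat3_simps)
  also have "\<dots> = 2 \<cdot>\<^sub>m 1\<^sub>m 6" by (rule eq_matI) auto
  finally have e: "four_block_mat (1\<^sub>m 3) (\<i> \<cdot>\<^sub>m C3) (1\<^sub>m 3) (- (\<i> \<cdot>\<^sub>m C3)) *
    four_block_mat (1\<^sub>m 3) (1\<^sub>m 3) (- \<i> \<cdot>\<^sub>m C3) (\<i> \<cdot>\<^sub>m C3) = 2 \<cdot>\<^sub>m 1\<^sub>m 6" .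
  have W0: "four_block_mat (1\<^sub>m 3) (\<i> \<cdot>\<^sub>m C3) (1\<^sub>m 3) (- (\<i> \<cdot>\<^sub>m C3)) \<in> carrier_mat 6 6"
    "four_block_mat (1\<^sub>m 3) (1\<^sub>m 3) (- \<i> \<cdot>\<^sub>m C3) (\<i> \<cdot>\<^sub>m C3) \<in> carrier_mat 6 6" by auto
  have "Z_block * mat_adjoint Z_block = 1\<^sub>m 6"
    unfolding Z_block_adjoint unfolding Z_block_def smult_mult_smult[OF W0] e sqrt_half_sq
    by (rule eq_matI) auto
  then have "unitary_mat (mat_adjoint Z_block)"
    using unitary_matI[of "mat_adjoint Z_block" 6] Z_block_carrier by simp
  then show ?thesis using unitary_mat_adjoint by fastforce
qed

text \<open>The Hermitian matrix \<open>\<i> C6\<close> has signature (3, 3), and the unitary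
\<^const>\<open>Z_block\<close> diagonalises it. This is the reason for multiplying the boundary
matrices by the inverse of \<^const>\<open>Z\<close>.\<close>

lemma Z_block_congruence_C6:
  "Z_block * C6 * mat_adjoint Z_block = four_block_mat (- \<i> \<cdot>\<^sub>m 1\<^sub>m 3) (0\<^sub>m 3 3) (0\<^sub>m 3 3) (\<i> \<cdot>\<^sub>m 1\<^sub>m 3)"
proof -
  let ?T = "\<i> \<cdot>\<^sub>m C3"
  have u: "- ?T = - \<i> \<cdot>\<^sub>m C3" by (intro eq_matI) auto
  have v: "- C3 = - 1 \<cdot>\<^sub>m C3" by (intro eq_matI) auto
  have 1: "1 \<cdot>\<^sub>m C3 = C3" by (intro eq_matI) auto
  have p: "?T * (- C3) = - \<i> \<cdot>\<^sub>m 1\<^sub>m 3" "(- ?T) * (- C3) = \<i> \<cdot>\<^sub>m 1\<^sub>m 3"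
    using smult_mult_smult[of C3 3 3 C3 3 "\<i>" "- 1"] smult_mult_smult[of C3 3 3 C3 3 "- \<i>" "- 1"]
    unfolding u v by (simp_all add: C3_sq)
  have q: "C3 * (- \<i> \<cdot>\<^sub>m C3) = - \<i> \<cdot>\<^sub>m 1\<^sub>m 3" "C3 * ?T = \<i> \<cdot>\<^sub>m 1\<^sub>m 3"
    using smult_mult_smult[of C3 3 3 C3 3 1 "- \<i>"] smult_mult_smult[of C3 3 3 C3 3 1 "\<i>"]
    unfolding 1 by (simp_all add: C3_sq)
  have "four_block_mat (1\<^sub>m 3) ?T (1\<^sub>m 3) (- ?T) * C6 = four_block_mat (- \<i> \<cdot>\<^sub>m 1\<^sub>m 3) C3 (\<i> \<cdot>\<^sub>m 1\<^sub>m 3) C3"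
    unfolding C6_block
    by (subst mult_four_block_mat[of _ 3 3 _ 3 _ 3 _ _ 3 _ 3]) (simp_all only: p, simp_all add: mat3_simps)
  moreover have "four_block_mat (- \<i> \<cdot>\<^sub>m 1\<^sub>m 3) C3 (\<i> \<cdot>\<^sub>m 1\<^sub>m 3) C3 * four_block_mat (1\<^sub>m 3) (1\<^sub>m 3) (- \<i> \<cdot>\<^sub>m C3) ?T
    = four_block_mat ((- \<i> \<cdot>\<^sub>m 1\<^sub>m 3) + (- \<i> \<cdot>\<^sub>m 1\<^sub>m 3)) ((- \<i> \<cdot>\<^sub>m 1\<^sub>m 3) + \<i> \<cdot>\<^sub>m 1\<^sub>m 3)
       (\<i> \<cdot>\<^sub>m 1\<^sub>m 3 + (- \<i> \<cdot>\<^sub>m 1\<^sub>m 3)) (\<i> \<cdot>\<^sub>m 1\<^sub>m 3 + \<i> \<cdot>\<^sub>m 1\<^sub>m 3)"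
    by (subst mult_four_block_mat[of _ 3 3 _ 3 _ 3 _ _ 3 _ 3]) (simp_all only: q, simp_all add: mat3_simps)
  moreover have "\<dots> = 2 \<cdot>\<^sub>m four_block_mat (- \<i> \<cdot>\<^sub>m 1\<^sub>m 3) (0\<^sub>m 3 3) (0\<^sub>m 3 3) (\<i> \<cdot>\<^sub>m 1\<^sub>m 3)"
    by (rule eq_matI) auto
  ultimately have e: "four_block_mat (1\<^sub>m 3) ?T (1\<^sub>m 3) (- ?T) * C6 * four_block_mat (1\<^sub>m 3) (1\<^sub>m 3) (- \<i> \<cdot>\<^sub>m C3) ?T
    = 2 \<cdot>\<^sub>m four_block_mat (- \<i> \<cdot>\<^sub>m 1\<^sub>m 3) (0\<^sub>m 3 3) (0\<^sub>m 3 3) (\<i> \<cdot>\<^sub>m 1\<^sub>m 3)" by metis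
  have c: "C6 \<in> carrier_mat 6 6" by (simp add: C6_def)
  have W0: "four_block_mat (1\<^sub>m 3) ?T (1\<^sub>m 3) (- ?T) \<in> carrier_mat 6 6"
    "four_block_mat (1\<^sub>m 3) (1\<^sub>m 3) (- \<i> \<cdot>\<^sub>m C3) ?T \<in> carrier_mat 6 6" by auto
  show ?thesis
    unfolding Z_block_adjoint unfolding Z_block_def
    unfolding mult_smult_assoc_mat[OF W0(1) c]
      smult_mult_smult[OF mult_carrier_mat[OF W0(1) c] W0(2)] e sqrt_half_sq
    by (rule eq_matI) auto
qed

lemma diag_block_mat_2:
  "diag_block_mat [A, B] = four_block_mat A (0\<^sub>m (dim_row A) (dim_col B)) (0\<^sub>m (dim_row B) (dim_col A)) B"
  using diag_block_mat_append[of "[A]" "[B]"] by (simp only: append.simps diag_block_mat_singleton Let_def)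

lemma diag_block_mat_4:
  "diag_block_mat [A, B, C, D] = diag_block_mat [diag_block_mat [A, B], diag_block_mat [C, D]]"
  using diag_block_mat_append[of "[A, B]" "[C, D]"] diag_block_mat_2[of "diag_block_mat [A, B]" "diag_block_mat [C, D]"]
  by (simp only: append.simps Let_def)

lemma diag_block_mat_2_mult:
  fixes A :: "'a :: comm_ring_1 mat"
  assumes "A \<in> carrier_mat n n" "B \<in> carrier_mat m m" "C \<in> carrier_mat n n" "D \<in> carrier_mat m m"
  shows "diag_block_mat [A, B] * diag_block_mat [C, D] =
    four_block_mat (A * C) (0\<^sub>m n m) (0\<^sub>m m n) (B * D)"
  unfolding diag_block_mat_2 using assms
  by (simp add: mult_four_block_mat[of _ n n _ m _ m _ _ n _ m])

lemma smult_diag_block: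
  fixes M :: "complex mat"
  assumes "M \<in> carrier_mat n n"
  shows "c \<cdot>\<^sub>m four_block_mat M (0\<^sub>m n n) (0\<^sub>m n n) M =
    four_block_mat (c \<cdot>\<^sub>m M) (0\<^sub>m n n) (0\<^sub>m n n) (c \<cdot>\<^sub>m M)"
  using assms by (intro eq_matI) auto

lemma Z_eq: "Z = four_block_mat Z_block (0\<^sub>m 6 6) (0\<^sub>m 6 6) Z_block"
proof -
  let ?H = "four_block_mat (1\<^sub>m 3) (1\<^sub>m 3) (1\<^sub>m 3) (- 1\<^sub>m 3) :: complex mat"
  let ?E = "diag_block_mat [1\<^sub>m 3, \<i> \<cdot>\<^sub>m C3]"
  have H: "?H \<in> carrier_mat 6 6" by auto
  have Ed: "?E = four_block_mat (1\<^sub>m 3) (0\<^sub>m 3 3) (0\<^sub>m 3 3) (\<i> \<cdot>\<^sub>m C3)"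
    unfolding diag_block_mat_2 by (simp add: carrier_matD[OF C3_carrier])
  have E: "?E \<in> carrier_mat 6 6" unfolding Ed by auto
  have HE: "?H * ?E = four_block_mat (1\<^sub>m 3) (\<i> \<cdot>\<^sub>m C3) (1\<^sub>m 3) (- (\<i> \<cdot>\<^sub>m C3))"
  proof -
    have "- 1\<^sub>m 3 * (\<i> \<cdot>\<^sub>m C3) = - (\<i> \<cdot>\<^sub>m C3)" 
      using uminus_mult_left_mat[of "1\<^sub>m 3" "\<i> \<cdot>\<^sub>m C3"] by (simp add: carrier_matD[OF C3_carrier])
    then show ?thesis
      unfolding Ed by (subst mult_four_block_mat[of _ 3 3 _ 3 _ 3 _ _ 3 _ 3]) (simp_all add: mat3_simps)
  qed
  have "diag_block_mat [?H, ?H] * diag_block_mat [1\<^sub>m 3, \<i> \<cdot>\<^sub>m C3, 1\<^sub>m 3, \<i> \<cdot>\<^sub>m C3]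
    = four_block_mat (?H * ?E) (0\<^sub>m 6 6) (0\<^sub>m 6 6) (?H * ?E)"
    unfolding diag_block_mat_4 by (rule diag_block_mat_2_mult[OF H H E E])
  then have "Z = complex_of_real (1 / sqrt 2) \<cdot>\<^sub>m four_block_mat (?H * ?E) (0\<^sub>m 6 6) (0\<^sub>m 6 6) (?H * ?E)"
    unfolding Z_def Let_def by (simp only:)
  also have "\<dots> = four_block_mat Z_block (0\<^sub>m 6 6) (0\<^sub>m 6 6) Z_block"
    unfolding HE Z_block_def by (rule smult_diag_block) simp
  finally show ?thesis .
qed

text \<open>In the new coordinates the form of \<open>A\<close> is, up to the factor
\<open>-\<i>\<close>, the difference of two Gram matrices. Equating it with that of \<open>B\<close>
and moving the negative terms across gives the sums of Gram matrices required by the normal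
form.\<close>

lemma gram_identity:
  fixes P Q :: "complex mat"
  assumes P: "P \<in> carrier_mat 6 3" and Q: "Q \<in> carrier_mat 6 3"
  shows "((P @\<^sub>c Q) * Z_block) * C6 * mat_adjoint ((P @\<^sub>c Q) * Z_block)
    = (- \<i> \<cdot>\<^sub>m (P * mat_adjoint P)) + (\<i> \<cdot>\<^sub>m (Q * mat_adjoint Q))"
proof -
  let ?M = "P @\<^sub>c Q"
  have M: "?M \<in> carrier_mat 6 6" using append_cols_carrier[OF P Q] by simp
  have c: "C6 \<in> carrier_mat 6 6" by (simp add: C6_def)
  note W = Z_block_carrier
  note sq = assoc_mult_mat[of _ 6 6 _ 6 _ 6] mult_carrier_mat[of _ 6 6 _ 6] mat_adjoint_mult[of _ 6 6 _ 6]
  have "(?M * Z_block) * C6 * mat_adjoint (?M * Z_block) = ?M * (Z_block * C6 * mat_adjoint Z_block) * mat_adjoint ?M"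
    using M c W by (simp add: sq)
  also have "?M * (Z_block * C6 * mat_adjoint Z_block) = (- \<i> \<cdot>\<^sub>m P) @\<^sub>c (\<i> \<cdot>\<^sub>m Q)"
    unfolding Z_block_congruence_C6 using P Q
    by (simp add: append_cols_mult_diag_block[of _ 6 3 _ 3 _ 3 _ 3] mult_smult_distrib[of _ 6 3 _ 3])
  also have "\<dots> * mat_adjoint ?M = (- \<i> \<cdot>\<^sub>m P) * mat_adjoint P + (\<i> \<cdot>\<^sub>m Q) * mat_adjoint Q"
    using P Q by (intro append_cols_mult_adjoint[of _ 6 3 _ 3]) auto
  also have "\<dots> = (- \<i> \<cdot>\<^sub>m (P * mat_adjoint P)) + (\<i> \<cdot>\<^sub>m (Q * mat_adjoint Q))"
    using P Q by (simp add: mult_smult_assoc_mat[of _ 6 3 _ 6])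
  finally show ?thesis .
qed

section \<open>Canonical form of self-adjoint boundary conditions\<close>

theorem lemma4p1:
  fixes A B :: "complex mat"
  assumes "A \<in> carrier_mat 6 6" and "B \<in> carrier_mat 6 6"
    and "vec_space.rank 6 (A @\<^sub>c B) = 6"
    and "A * C6 * mat_adjoint A = B * C6 * mat_adjoint B"
  shows "\<exists>U U1 U2 V1 V2 C S :: complex mat.
    U \<in> carrier_mat 6 6 \<and> invertible_mat U \<and>
    U1 \<in> carrier_mat 3 3 \<and> unitary_mat U1 \<and>
    U2 \<in> carrier_mat 3 3 \<and> unitary_mat U2 \<and>
    V1 \<in> carrier_mat 3 3 \<and> unitary_mat V1 \<and>
    V2 \<in> carrier_mat 3 3 \<and> unitary_mat V2 \<and>
    C \<in> carrier_mat 3 3 \<and> diagonal_mat C \<and> pos_semidef_mat C \<and>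
    S \<in> carrier_mat 3 3 \<and> diagonal_mat S \<and> pos_semidef_mat S \<and>
    C ^\<^sub>m 2 + S ^\<^sub>m 2 = 1\<^sub>m 3 \<and>
    A @\<^sub>c B =
      U * (four_block_mat C (1\<^sub>m 3) (- S) (0\<^sub>m 3 3) @\<^sub>c four_block_mat (0\<^sub>m 3 3) S (1\<^sub>m 3) C)
        * diag_block_mat [V1, mat_adjoint U1, mat_adjoint U2, V2] * Z \<and>
    (separated_bc A B \<longleftrightarrow> S = 0\<^sub>m 3 3) \<and>
    (mixed_bc A B \<longleftrightarrow> 0 < vec_space.rank 3 S \<and> vec_space.rank 3 S < 3) \<and>
    (coupled_bc A B \<longleftrightarrow> vec_space.rank 3 S = 3)"
proof -
  note A = assms(1) and B = assms(2)
  note W = Z_block_carrier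
  have Wa: "mat_adjoint Z_block \<in> carrier_mat 6 6" using W by simp
  note uW = unitary_matD[OF Z_block_unitary W]
  \<comment> \<open>Coordinates in which \<open>C6\<close> is diagonal; the three columns of
    \<open>P\<close> belong to the eigenvalue \<open>-\<i>\<close> and those of \<open>Q\<close> to
    \<open>\<i>\<close>.\<close>
  have split: "\<exists>P Q. P \<in> carrier_mat 6 3 \<and> Q \<in> carrier_mat 6 3 \<and> M = (P @\<^sub>c Q) * Z_block"
    if M: "M \<in> carrier_mat 6 6" for M
  proof -
    have "M * mat_adjoint Z_block \<in> carrier_mat 6 (3 + 3)" using M Wa by simp
    then obtain P Q where PQ: "P \<in> carrier_mat 6 3" "Q \<in> carrier_mat 6 3" "M * mat_adjoint Z_block = P @\<^sub>c Q"
      by (rule append_cols_split)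
    have "(P @\<^sub>c Q) * Z_block = M * (mat_adjoint Z_block * Z_block)"
      unfolding PQ(3)[symmetric] by (rule assoc_mult_mat[OF M Wa W])
    then have "M = (P @\<^sub>c Q) * Z_block" using uW M by simp
    with PQ show ?thesis by blast
  qed
  obtain P Q where PQ: "P \<in> carrier_mat 6 3" "Q \<in> carrier_mat 6 3" "A = (P @\<^sub>c Q) * Z_block"
    using split[OF A] by blast
  obtain R T where RT: "R \<in> carrier_mat 6 3" "T \<in> carrier_mat 6 3" "B = (R @\<^sub>c T) * Z_block"
    using split[OF B] by blast
  have PQc: "P @\<^sub>c Q \<in> carrier_mat 6 6" and RTc: "R @\<^sub>c T \<in> carrier_mat 6 6"
    using append_cols_carrier[OF PQ(1,2)] append_cols_carrier[OF RT(1,2)] by auto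
  have gram: "P * mat_adjoint P + T * mat_adjoint T = Q * mat_adjoint Q + R * mat_adjoint R"
  proof -
    have sk: "(- \<i> \<cdot>\<^sub>m (P * mat_adjoint P)) + (\<i> \<cdot>\<^sub>m (Q * mat_adjoint Q)) =
      (- \<i> \<cdot>\<^sub>m (R * mat_adjoint R)) + (\<i> \<cdot>\<^sub>m (T * mat_adjoint T))"
      using assms(4) unfolding PQ(3) RT(3) gram_identity[OF PQ(1,2)] gram_identity[OF RT(1,2)] .
    have g: "X * mat_adjoint X \<in> carrier_mat 6 6" if "X \<in> carrier_mat 6 3" for X :: "complex mat"
      using that by (auto intro: mult_carrier_mat)
    note g' = g[OF PQ(1)] g[OF PQ(2)] g[OF RT(1)] g[OF RT(2)]
    show ?thesis
    proof (rule eq_matI)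
      fix i j assume "i < dim_row (Q * mat_adjoint Q + R * mat_adjoint R)"
        "j < dim_col (Q * mat_adjoint Q + R * mat_adjoint R)"
      then have ij: "i < 6" "j < 6" using g' by auto
      have "- \<i> * (P * mat_adjoint P) $$ (i, j) + \<i> * (Q * mat_adjoint Q) $$ (i, j) =
        - \<i> * (R * mat_adjoint R) $$ (i, j) + \<i> * (T * mat_adjoint T) $$ (i, j)"
        using arg_cong[OF sk, of "\<lambda>M. M $$ (i, j)"] carrier_matD[OF g'(1)] carrier_matD[OF g'(2)]
          carrier_matD[OF g'(3)] carrier_matD[OF g'(4)] ij
        by (simp del: index_mult_mat)
      then have "\<i> * ((P * mat_adjoint P) $$ (i, j) + (T * mat_adjoint T) $$ (i, j)) =
        \<i> * ((Q * mat_adjoint Q) $$ (i, j) + (R * mat_adjoint R) $$ (i, j))"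
        by (simp add: algebra_simps del: index_mult_mat)
      then have "(P * mat_adjoint P) $$ (i, j) + (T * mat_adjoint T) $$ (i, j) =
        (Q * mat_adjoint Q) $$ (i, j) + (R * mat_adjoint R) $$ (i, j)"
        by (simp del: index_mult_mat)
      then show "(P * mat_adjoint P + T * mat_adjoint T) $$ (i, j) =
        (Q * mat_adjoint Q + R * mat_adjoint R) $$ (i, j)"
        using carrier_matD[OF g'(3)] carrier_matD[OF g'(4)] ij by (simp del: index_mult_mat)
    qed (use PQ RT in auto)
  qed
  have ker: "w = 0\<^sub>v (3 + 3)"
    if w: "w \<in> carrier_vec (3 + 3)" and "mat_adjoint P *\<^sub>v w = 0\<^sub>v 3" "mat_adjoint Q *\<^sub>v w = 0\<^sub>v 3"
      "mat_adjoint R *\<^sub>v w = 0\<^sub>v 3" "mat_adjoint T *\<^sub>v w = 0\<^sub>v 3" for w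
  proof -
    have w6: "w \<in> carrier_vec 6" using w by simp
    have zero: "mat_adjoint (M * Z_block) *\<^sub>v w = 0\<^sub>v 6"
      if M: "M \<in> carrier_mat 6 6" and k: "mat_adjoint M *\<^sub>v w = 0\<^sub>v 6" for M
    proof -
      have Ma: "mat_adjoint M \<in> carrier_mat 6 6" using M by simp
      have "mat_adjoint (M * Z_block) *\<^sub>v w = mat_adjoint Z_block *\<^sub>v (mat_adjoint M *\<^sub>v w)"
        unfolding mat_adjoint_mult[OF M W] by (rule assoc_mult_mat_vec[OF Wa Ma w6])
      then show ?thesis unfolding k using Wa W by (auto intro!: eq_vecI)
    qed
    have "mat_adjoint (P @\<^sub>c Q) *\<^sub>v w = 0\<^sub>v 6" "mat_adjoint (R @\<^sub>c T) *\<^sub>v w = 0\<^sub>v 6"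
      using adjoint_append_cols_mult_vec_eq_0[OF PQ(1,2) w6] adjoint_append_cols_mult_vec_eq_0[OF RT(1,2) w6] that
      by auto
    then have "mat_adjoint A *\<^sub>v w = 0\<^sub>v 6" "mat_adjoint B *\<^sub>v w = 0\<^sub>v 6"
      unfolding PQ(3) RT(3) using zero PQc RTc by auto
    then have "mat_adjoint (A @\<^sub>c B) *\<^sub>v w = 0\<^sub>v (6 + 6)"
      using adjoint_append_cols_mult_vec_eq_0[OF A B w6] by simp
    then show ?thesis using full_row_rank_adjoint_kernel[OF append_cols_carrier[OF A B] assms(3) w6] by simp
  qed
  have six: "P \<in> carrier_mat (3 + 3) 3" "Q \<in> carrier_mat (3 + 3) 3" "R \<in> carrier_mat (3 + 3) 3"
    "T \<in> carrier_mat (3 + 3) 3" using PQ RT by auto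
  obtain U U' U1 U2 V1 V2 C S where nf:
    "U \<in> carrier_mat (3 + 3) (3 + 3)" "U' \<in> carrier_mat (3 + 3) (3 + 3)" "U * U' = 1\<^sub>m (3 + 3)"
    "U1 \<in> carrier_mat 3 3" "U2 \<in> carrier_mat 3 3" "V1 \<in> carrier_mat 3 3" "V2 \<in> carrier_mat 3 3"
    "unitary_mat U1" "unitary_mat U2" "unitary_mat V1" "unitary_mat V2"
    "C \<in> carrier_mat 3 3" "nonneg_diagonal C" "S \<in> carrier_mat 3 3" "nonneg_diagonal S"
    "C * C + S * S = 1\<^sub>m 3"
    "P @\<^sub>c Q = U * four_block_mat C (1\<^sub>m 3) (- S) (0\<^sub>m 3 3) *
      four_block_mat V1 (0\<^sub>m 3 3) (0\<^sub>m 3 3) (mat_adjoint U1)"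
    "R @\<^sub>c T = U * four_block_mat (0\<^sub>m 3 3) S (1\<^sub>m 3) C *
      four_block_mat (mat_adjoint U2) (0\<^sub>m 3 3) (0\<^sub>m 3 3) V2"
    using cs_normal_form[OF six gram ker] by blast
  let ?A0 = "four_block_mat C (1\<^sub>m 3) (- S) (0\<^sub>m 3 3)" and ?B0 = "four_block_mat (0\<^sub>m 3 3) S (1\<^sub>m 3) C"
  let ?DA = "four_block_mat V1 (0\<^sub>m 3 3) (0\<^sub>m 3 3) (mat_adjoint U1)"
  let ?DB = "four_block_mat (mat_adjoint U2) (0\<^sub>m 3 3) (0\<^sub>m 3 3) V2"
  have U: "U \<in> carrier_mat 6 6" "U' \<in> carrier_mat 6 6" "U * U' = 1\<^sub>m 6" using nf by auto
  have U1a: "mat_adjoint U1 \<in> carrier_mat 3 3" "unitary_mat (mat_adjoint U1)"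
    and U2a: "mat_adjoint U2 \<in> carrier_mat 3 3" "unitary_mat (mat_adjoint U2)"
    using nf by (auto intro: unitary_mat_adjoint)
  have A0: "?A0 \<in> carrier_mat 6 6" using four_block_carrier_mat[OF nf(12), of "0\<^sub>m 3 3" 3 3] by simp
  have B0: "?B0 \<in> carrier_mat 6 6" using four_block_carrier_mat[OF _ nf(12), of "0\<^sub>m 3 3" 3 3] by simp
  have DA: "?DA \<in> carrier_mat 6 6" "unitary_mat ?DA"
    using four_block_carrier_mat[OF nf(6) U1a(1)] unitary_mat_diag_block[OF nf(10) U1a(2) nf(6) U1a(1)] by auto
  have DB: "?DB \<in> carrier_mat 6 6" "unitary_mat ?DB"
    using four_block_carrier_mat[OF U2a(1) nf(7)] unitary_mat_diag_block[OF U2a(2) nf(11) U2a(1) nf(7)] by auto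
  have Ae: "A = U * ?A0 * (?DA * Z_block)"
    unfolding PQ(3) nf(17) by (rule assoc_mult_mat[OF mult_carrier_mat[OF U(1) A0] DA(1) W])
  have Be: "B = U * ?B0 * (?DB * Z_block)"
    unfolding RT(3) nf(18) by (rule assoc_mult_mat[OF mult_carrier_mat[OF U(1) B0] DB(1) W])
  have AB: "A @\<^sub>c B = U * (?A0 @\<^sub>c ?B0) * diag_block_mat [V1, mat_adjoint U1, mat_adjoint U2, V2] * Z"
  proof -
    have d: "diag_block_mat [V1, mat_adjoint U1, mat_adjoint U2, V2] = four_block_mat ?DA (0\<^sub>m 6 6) (0\<^sub>m 6 6) ?DB"
    proof -
      have "diag_block_mat [V1, mat_adjoint U1] = ?DA" "diag_block_mat [mat_adjoint U2, V2] = ?DB"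
        unfolding diag_block_mat_2 using nf by auto
      then show ?thesis
        unfolding diag_block_mat_4 diag_block_mat_2[of "diag_block_mat _"] by (simp only: carrier_matD[OF DA(1)] carrier_matD[OF DB(1)])
    qed
    show ?thesis
      unfolding d Z_eq mult_append_cols[OF U(1) A0 B0]
        append_cols_mult_diag_block[OF mult_carrier_mat[OF U(1) A0] mult_carrier_mat[OF U(1) B0] DA(1) DB(1)]
        nf(17,18)[symmetric] append_cols_mult_diag_block[OF PQc RTc W W]
      using PQ RT by simp
  qed
  have dS: "diagonal_mat S" and dC: "diagonal_mat C" using nf by (auto simp: nonneg_diagonal_def)
  have inv: "D * Z_block \<in> carrier_mat (3 + 3) (3 + 3) \<and> mat_adjoint (D * Z_block) \<in> carrier_mat (3 + 3) (3 + 3) \<and>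
      (D * Z_block) * mat_adjoint (D * Z_block) = 1\<^sub>m (3 + 3)"
    if "D \<in> carrier_mat 6 6" "unitary_mat D" for D
    using unitary_matD(2)[OF unitary_mat_mult[OF that(2) Z_block_unitary that(1) W] mult_carrier_mat[OF that(1) W]]
      mult_carrier_mat[OF that(1) W] mat_adjoint_carrier[OF mult_carrier_mat[OF that(1) W]] by simp
  have rA: "vec_space.rank 6 A = 3 + vec_space.rank 3 S"
    using rank_cs_block(1)[OF nf(1-3) _ _ _ nf(12,14) dS, of "?DA * Z_block" "mat_adjoint (?DA * Z_block)"] inv[OF DA]
    unfolding Ae by simp
  have rB: "vec_space.rank 6 B = 3 + vec_space.rank 3 S"
    using rank_cs_block(2)[OF nf(1-3) _ _ _ nf(12,14) dS, of "?DB * Z_block" "mat_adjoint (?DB * Z_block)"] inv[OF DB]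
    unfolding Be by simp
  have bc: "bc_ranks A B r \<longleftrightarrow> vec_space.rank 3 S = r" for r
    using rA rB by (auto simp: bc_ranks_def)
  have rS0: "vec_space.rank 3 S = 0 \<longleftrightarrow> S = 0\<^sub>m 3 3"
    using rank_diagonal_eq_0[OF nf(14) dS] .
  have "U' * U = 1\<^sub>m 6" by (rule mat_mult_left_right_inverse[OF U])
  then have "invertible_mat U"
    using U by (auto simp: invertible_mat_def inverts_mat_def)
  moreover have "C ^\<^sub>m 2 + S ^\<^sub>m 2 = 1\<^sub>m 3" using nf by (simp add: numeral_2_eq_2)
  moreover have "separated_bc A B \<longleftrightarrow> S = 0\<^sub>m 3 3" by (simp add: separated_bc_def bc rS0)
  moreover have "mixed_bc A B \<longleftrightarrow> 0 < vec_space.rank 3 S \<and> vec_space.rank 3 S < 3"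
    by (auto simp: mixed_bc_def bc)
  moreover have "coupled_bc A B \<longleftrightarrow> vec_space.rank 3 S = 3" by (simp add: coupled_bc_def bc)
  moreover have "pos_semidef_mat C" "pos_semidef_mat S"
    using nonneg_diagonal_pos_semidef nf by blast+
  ultimately show ?thesis
    using U(1) nf(4-12,14) dS dC AB by blast
qed

end
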